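(* Let $R>1$, let $f:D_R\to\mathbb{C}$ be analytic in $D_R$, $f(z)=\sum_{p=0}^\infty c_p z^p$, and let $l\in\mathbb{N}$. If $f$ is not a polynomial of degree $\le\max\{1,l-1\}$, then for all $1\le r<r_1<R$ we have $\|(G_n^\alpha(f))^{(l)}-f^{(l)}\|_r\sim\frac1n$, $n\in\mathbb{N}$, for $\alpha\in[0,1]$, with constants in the equivalence depending only on $f,r,r_1$ and $l$; that is, there exist constants $0<M_1\le M_2<\infty$ depending only on $f,r,r_1,l$ such that for all $\alpha\in[0,1]$ and all $n\in\mathbb{N}$, $$\frac{M_1}{n}\le\|(G_n^{\alpha}(f))^{(l)}-f^{(l)}\|_r\le\frac{M_2}{n}.$$
   Context: $\mathbb{N}=\{1,2,3,\dots\}$; $D_R=\{z\in\mathbb{C}:|z|<R\}$, $\overline{D}_r=\{z\in\mathbb{C}:|z|\le r\}$, and $\|g\|_r=\max_{z\in\overline{D}_r}|g(z)|$. $G_n^\alpha(f)$ denotes the function $z\mapsto G_n^\alpha(f;z)$, and the superscript $(l)$ denotes the $l$-th derivative with respect to $z$. For $0\le k\le n$ let $p_{n,k}(t)=\binom{n}{k}t^k(1-t)^{n-k}$. For $\alpha\in[0,1]$ the $\alpha$-Bernstein polynomials are $q_{1,0}^\alpha(z)=1-z$, $q_{1,1}^\alpha(z)=z$ and, for $n\ge2$, $0\le k\le n$, $$q_{n,k}^\alpha(z)=\left[\binom{n-2}{k}(1-\alpha)z+\binom{n-2}{k-2}(1-\alpha)(1-z)+\binom{n}{k}\alpha z(1-z)\right]z^{k-1}(1-z)^{n-k-1},$$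 where $\binom{m}{j}=0$ if $j<0$ or $j>m$, and the expression is understood as a polynomial in $z$ after cancellation (e.g. $q_{n,0}^\alpha(z)=(1-\alpha)(1-z)^{n-1}+\alpha(1-z)^n$ and $q_{n,n}^\alpha(z)=(1-\alpha)z^{n-1}+\alpha z^n$). For $n\in\mathbb{N}$, $\alpha\in[0,1]$, $z\in\mathbb{C}$ and $f$ a complex-valued analytic function in $D_R$ with $R>1$, the complex genuine $\alpha$-Bernstein-Durrmeyer operator is $$G_n^\alpha(f;z)=q_{n,0}^\alpha(z)f(0)+q_{n,n}^\alpha(z)f(1)+(n-1)\sum_{k=1}^{n-1}q_{n,k}^\alpha(z)\int_0^1 p_{n-2,k-1}(t)f(t)\,dt$$ (the sum is empty for $n=1$). *)

theory Defs
  imports "HOL-Complex_Analysis.Complex_Analysis" "HOL-Computational_Algebra.Polynomial"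
begin

text \<open>
  The \<open>\<alpha>\<close>-Bernstein polynomials, for \<open>k \<le> n\<close> and \<open>n \<ge> 1\<close>. For \<open>n \<ge> 2\<close> the textbook formula has the
  common factor \<open>z\<^bsup>k-1\<^esup> (1 - z)\<^bsup>n-k-1\<^esup>\<close>, whose exponents may be \<open>-1\<close>; here that factor is multiplied into
  the bracket. Truncated subtraction in the exponents only matters where the binomial coefficient in
  front vanishes; the guard \<open>k \<ge> 2\<close> encodes the convention that the binomial coefficient with lower
  index \<open>k - 2 < 0\<close> is zero.
\<close>

definition alpha_bernstein :: "real \<Rightarrow> nat \<Rightarrow> nat \<Rightarrow> complex \<Rightarrow> complex" where
  "alpha_bernstein \<alpha> n k z =
     (if n = 1 then (if k = 0 then 1 - z else z)
      else of_nat ((n - 2) choose k) * of_real (1 - \<alpha>) * z ^ k * (1 - z) ^ (n - k - 1)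
         + (if k \<ge> 2 then of_nat ((n - 2) choose (k - 2)) * of_real (1 - \<alpha>)
                            * z ^ (k - 1) * (1 - z) ^ (n - k)
            else 0)
         + of_nat (n choose k) * of_real \<alpha> * z ^ k * (1 - z) ^ (n - k))"

lemma alpha_bernstein_uncancelled:
  assumes "n \<ge> 2" "k \<le> n" "z \<noteq> 0" "z \<noteq> 1"
  shows "alpha_bernstein \<alpha> n k z =
    (of_nat ((n - 2) choose k) * of_real (1 - \<alpha>) * z
     + (if k \<ge> 2 then of_nat ((n - 2) choose (k - 2)) else 0) * of_real (1 - \<alpha>) * (1 - z)
     + of_nat (n choose k) * of_real \<alpha> * z * (1 - z))
    * z powi (int k - 1) * (1 - z) powi (int n - int k - 1)"
proof -
  have w: "1 - z \<noteq> 0" using assms by simp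
  have shift: "a * a powi (m - 1) = a powi m" if "a \<noteq> 0" for a :: complex and m
    using that by (simp add: power_int_diff)
  have 1: "z * z powi (int k - 1) = z ^ k"
    using shift[OF assms(3), of "int k"] by simp
  have "int n - int k - 1 = int (n - k) - 1" using assms(2) by linarith
  then have 2: "(1 - z) * (1 - z) powi (int n - int k - 1) = (1 - z) ^ (n - k)"
    using shift[OF w, of "int (n - k)"] by (simp only: power_int_of_nat)
  have 3: "of_nat ((n - 2) choose k) * (1 - z) powi (int n - int k - 1)
           = of_nat ((n - 2) choose k) * (1 - z) ^ (n - k - 1)"
  proof (cases "k \<le> n - 2")
    case True
    then have "int n - int k - 1 = int (n - k - 1)" using assms(1) by linarith
    then show ?thesis by (metis power_int_of_nat)
  qed (simp add: binomial_eq_0)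
  have 4: "z powi (int k - 1) = z ^ (k - 1)" if "k \<ge> 2"
  proof -
    have "int k - 1 = int (k - 1)" using that by linarith
    then show ?thesis by (metis power_int_of_nat)
  qed
  let ?a = "z powi (int k - 1)" and ?b = "(1 - z) powi (int n - int k - 1)"
  let ?C = "of_nat ((n - 2) choose k) :: complex"
  let ?D = "(if k \<ge> 2 then of_nat ((n - 2) choose (k - 2)) else 0) :: complex"
  let ?E = "of_nat (n choose k) :: complex"
  have "(?C * of_real (1 - \<alpha>) * z + ?D * of_real (1 - \<alpha>) * (1 - z) + ?E * of_real \<alpha> * z * (1 - z)) * ?a * ?b
     = of_real (1 - \<alpha>) * (z * ?a) * (?C * ?b) + ?D * of_real (1 - \<alpha>) * ?a * ((1 - z) * ?b)
       + ?E * of_real \<alpha> * (z * ?a) * ((1 - z) * ?b)"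
    by (simp add: algebra_simps)
  also have "\<dots> = of_real (1 - \<alpha>) * z ^ k * (?C * (1 - z) ^ (n - k - 1))
       + ?D * of_real (1 - \<alpha>) * ?a * (1 - z) ^ (n - k) + ?E * of_real \<alpha> * z ^ k * (1 - z) ^ (n - k)"
    by (simp only: 1 2 3)
  also have "\<dots> = alpha_bernstein \<alpha> n k z"
    using assms(1) 4 by (simp add: alpha_bernstein_def mult_ac)
  finally show ?thesis by simp
qed

lemma alpha_bernstein_0:
  assumes "n \<ge> 2"
  shows "alpha_bernstein \<alpha> n 0 z = of_real (1 - \<alpha>) * (1 - z) ^ (n - 1) + of_real \<alpha> * (1 - z) ^ n"
  using assms by (simp add: alpha_bernstein_def)

lemma alpha_bernstein_n:
  assumes "n \<ge> 2"
  shows "alpha_bernstein \<alpha> n n z = of_real (1 - \<alpha>) * z ^ (n - 1) + of_real \<alpha> * z ^ n"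
  using assms by (simp add: alpha_bernstein_def binomial_eq_0)

text \<open>The complex genuine \<open>\<alpha>\<close>-Bernstein--Durrmeyer operator, for \<open>n \<ge> 1\<close>.\<close>

definition genuine_BD :: "real \<Rightarrow> nat \<Rightarrow> (complex \<Rightarrow> complex) \<Rightarrow> complex \<Rightarrow> complex" where
  "genuine_BD \<alpha> n f z =
     alpha_bernstein \<alpha> n 0 z * f 0 + alpha_bernstein \<alpha> n n z * f 1
     + (of_nat n - 1) * (\<Sum>k = 1..n - 1. alpha_bernstein \<alpha> n k z *
         integral {0..1} (\<lambda>t. of_real (Bernstein (n - 2) (k - 1) t) * f (of_real t)))"

text \<open>For \<open>g\<close> continuous on the closed disc, the supremum is attained.\<close>

definition disc_norm :: "real \<Rightarrow> (complex \<Rightarrow> complex) \<Rightarrow> real" where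
  "disc_norm r g = (SUP z\<in>cball 0 r. norm (g z))"

end

theory Submission
  imports Defs "HOL-Real_Asymp.Real_Asymp"
begin

text \<open>
  Expanding rising factorials into falling ones (Lah numbers, which are nonnegative) shows that the
  operator maps \<open>z ^ p\<close> to a polynomial of degree at most \<open>p\<close> with nonnegative coefficients of sum \<open>1\<close>, whose
  \<open>p\<close>-th coefficient differs from \<open>1\<close> by at most \<open>2 p\<^sup>2 / n\<close>, uniformly in \<open>\<alpha>\<close>. Differentiating the
  power series termwise gives the upper bound.

  For the lower bound, Cauchy's inequality bounds the norm of the \<open>l\<close>-th derivative from below by any Taylor
  coefficient of index \<open>m \<ge> l\<close> of the error at 0. Multiplied by \<open>n\<close>, such a coefficient tends to
  \<open>m (m + 1) c (m + 1) - m (m - 1) c m\<close> by Tannery's theorem, and this is nonzero for some \<open>m \<ge> l\<close>. For each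
  single \<open>n\<close> some coefficient is bounded away from 0 uniformly in \<open>\<alpha>\<close>, because the operator produces polynomials
  of degree at most \<open>n\<close> and strictly shrinks leading coefficients.
\<close>

subsection \<open>Images of monomials\<close>

text \<open>The unsigned Lah numbers, through their triangular recurrence: the connection
  coefficients from rising to falling factorials.\<close>

fun lah :: "nat \<Rightarrow> nat \<Rightarrow> nat" where
  "lah 0 j = (if j = 0 then 1 else 0)"
| "lah (Suc p) 0 = p * lah p 0"
| "lah (Suc p) (Suc j) = lah p j + (p + Suc j) * lah p (Suc j)"

lemma lah_eq_0: "p < j \<Longrightarrow> lah p j = 0"
  by (induction p j rule: lah.induct) auto

lemma lah_diag: "lah p p = 1"
  by (induction p) (auto simp: lah_eq_0)

lemma lah_subdiag: "lah (Suc p) p = p * Suc p"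
  by (induction p) (auto simp: lah_diag algebra_simps)

text \<open>Write \<open>k + p\<close> as \<open>(k - j) + (p + j)\<close>: the factor
  \<open>k - j\<close> raises the order of the falling factorial by one. This identity produces the
  recurrence of \<open>lah\<close>.\<close>

lemma fact_times_binomial_mult:
  "fact j * (k choose j) * (k + p) = fact (Suc j) * (k choose Suc j) + (p + j) * (fact j * (k choose j))"
  for j k p :: nat
proof (cases "j \<le> k")
  case True
  then obtain i where i: "k = j + i" using le_Suc_ex by blast
  have "Suc j * (k choose Suc j) = i * (k choose j)"
    using binomial_absorb_comp[of k j] i  by (metis Suc_times_binomial_eq add_diff_cancel_left' binomial_absorption diff_Suc_1 mult.commute)
  then have "fact (Suc j) * (k choose Suc j) = i * (fact j * (k choose j))"
    by (metis (no_types, opaque_lifting) fact_Suc mult.assoc mult.commute of_nat_id)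
  then show ?thesis using i by (simp add: algebra_simps)
qed (simp add: binomial_eq_0)

lemma pochhammer_eq_sum_lah:
  "pochhammer k p = (\<Sum>j\<le>p. lah p j * (fact j * (k choose j)))" for k p :: nat
proof (induction p)
  case 0
  then show ?case by simp
next
  case (Suc p)
  let ?F = "\<lambda>j. fact j * (k choose j) :: nat"
  have "pochhammer k (Suc p) = (\<Sum>j\<le>p. lah p j * (?F j * (k + p)))"
    by (simp add: pochhammer_Suc Suc.IH sum_distrib_right mult.assoc)
  also have "\<dots> = (\<Sum>j\<le>p. lah p j * ?F (Suc j)) + (\<Sum>j\<le>p. (p + j) * lah p j * ?F j)"
    unfolding fact_times_binomial_mult sum.distrib[symmetric]
    by (intro sum.cong refl) (simp only: distrib_left distrib_right mult_ac)
  \<comment> \<open>The added term vanishes because \<open>lah p (Suc p) = 0\<close>; with it the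
    index shift lines up with the recurrence.\<close>
  also have "(\<Sum>j\<le>p. (p + j) * lah p j * ?F j) = (\<Sum>j\<le>Suc p. (p + j) * lah p j * ?F j)"
    by (simp add: lah_eq_0)
  also have "\<dots> = p * lah p 0 * ?F 0 + (\<Sum>j\<le>p. (p + Suc j) * lah p (Suc j) * ?F (Suc j))"
    by (subst sum.atMost_Suc_shift) simp
  also have "(\<Sum>j\<le>p. lah p j * ?F (Suc j)) + \<dots> = (\<Sum>j\<le>Suc p. lah (Suc p) j * ?F j)"
    by (subst sum.atMost_Suc_shift) (simp add: sum.distrib[symmetric] algebra_simps del: fact_Suc)
  finally show ?case .
qed

section \<open>Factorial moments of the basis polynomials\<close>

text \<open>Since \<open>(n choose k) * (k choose j)\<close> equals
  \<open>(n choose j) * ((n - j) choose (k - j))\<close>, what remains is the binomial expansion of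
  \<open>(z + (1 - z)) ^ (n - j)\<close>.\<close>

lemma sum_binomial_choose:
  fixes z :: "'a::comm_ring_1"
  shows "(\<Sum>k\<le>n. of_nat (n choose k) * z ^ k * (1 - z) ^ (n - k) * of_nat (k choose j))
       = of_nat (n choose j) * z ^ j"
proof (cases "j \<le> n")
  case True
  have "(\<Sum>k\<le>n. of_nat (n choose k) * z ^ k * (1 - z) ^ (n - k) * of_nat (k choose j))
      = (\<Sum>k=j..n. of_nat (n choose k) * z ^ k * (1 - z) ^ (n - k) * of_nat (k choose j))"
    by (rule sum.mono_neutral_right) (auto simp: binomial_eq_0)
  also have "\<dots> = (\<Sum>i=0..n-j. of_nat (n choose (i + j)) * z ^ (i + j) * (1 - z) ^ (n - (i + j)) * of_nat ((i + j) choose j))"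
    using sum.shift_bounds_cl_nat_ivl[of "\<lambda>k. of_nat (n choose k) * z ^ k * (1 - z) ^ (n - k) * of_nat (k choose j)" 0 j "n - j"] True
    by simp
  also have "\<dots> = (\<Sum>i=0..n-j. of_nat (n choose j) * z ^ j * (of_nat ((n - j) choose i) * z ^ i * (1 - z) ^ (n - j - i)))"
  proof (intro sum.cong refl)
    fix i assume i: "i \<in> {0..n-j}"
    have "of_nat (n choose (i + j)) * of_nat ((i + j) choose j) = (of_nat (n choose j) * of_nat ((n - j) choose i) :: 'a)"
      using choose_mult[of j "i + j" n] i True unfolding of_nat_mult[symmetric] by simp
    then show "of_nat (n choose (i + j)) * z ^ (i + j) * (1 - z) ^ (n - (i + j)) * of_nat ((i + j) choose j)
       = of_nat (n choose j) * z ^ j * (of_nat ((n - j) choose i) * z ^ i * (1 - z) ^ (n - j - i))"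
      by (simp add: power_add mult_ac add.commute[of j i]) (simp add: mult.assoc[symmetric])
  qed
  also have "\<dots> = of_nat (n choose j) * z ^ j * (z + (1 - z)) ^ (n - j)"
    unfolding binomial_ring sum_distrib_left[symmetric] atMost_atLeast0 ..
  finally show ?thesis by simp
qed (simp add: binomial_eq_0)

text \<open>For \<open>n = 1\<close> the basis polynomials do not depend on \<open>\<alpha>\<close>; the guard \<open>2 \<le> n\<close> removes the \<open>\<alpha>\<close>-term there.\<close>

definition shifted_binomial :: "nat \<Rightarrow> nat \<Rightarrow> nat" where
  "shifted_binomial n j = (if 2 \<le> n \<and> 2 \<le> j then (n - 2) choose (j - 2) else 0)"

text \<open>Pascal's rule applied twice; the guards stand for the vanishing of binomials with
  negative lower index.\<close>

lemma choose_Suc2: "Suc (Suc k) choose j = (k choose j) + 2 * (if 1 \<le> j then k choose (j - 1) else 0)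
    + (if 2 \<le> j then k choose (j - 2) else 0)"
  by (cases j; cases "j - 1") (auto simp: numeral_2_eq_2)

lemma shifted_binomial_le: "shifted_binomial n j \<le> n choose j"
proof (cases "2 \<le> n \<and> 2 \<le> j")
  case True
  then have "Suc (Suc (n - 2)) = n" by linarith
  then show ?thesis using choose_Suc2[of "n - 2" j] True by (simp add: shifted_binomial_def)
qed (auto simp: shifted_binomial_def)

text \<open>For \<open>n \<ge> 2\<close> the basis is a mixture: weight \<open>\<alpha>\<close> on
  the classical basis of order \<open>n\<close>, and weight \<open>1 - \<alpha>\<close> on that of
  order \<open>n - 2\<close>, taken once in place with factor \<open>1 - z\<close> and once shifted
  by two with factor \<open>z\<close>. Pascal's rule brings the moments back to order
  \<open>n\<close>.\<close>

lemma sum_alpha_bernstein_choose: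
  assumes "n \<ge> 1"
  shows "(\<Sum>k\<le>n. alpha_bernstein \<alpha> n k z * of_nat (k choose j))
       = of_nat (n choose j) * z ^ j + of_real (1 - \<alpha>) * of_nat (shifted_binomial n j) * (z ^ (j - 1) - z ^ j)"
proof (cases "n = 1")
  case True
  then show ?thesis using sum_binomial_choose[of 1 z j]
    by (simp add: alpha_bernstein_def shifted_binomial_def)
next
  case False
  with assms obtain m where n: "n = Suc (Suc m)" by (metis One_nat_def Suc_le_D le_SucE le_zero_eq not0_implies_Suc not_less_eq_eq)
  let ?B = "\<lambda>k. of_nat (m choose k) * z ^ k * (1 - z) ^ (m - k)"
  let ?a = "of_real \<alpha> :: complex" and ?b = "of_real (1 - \<alpha>) :: complex"
  have S1: "(\<Sum>k\<le>n. of_nat (n choose k) * ?a * z ^ k * (1 - z) ^ (n - k) * of_nat (k choose j)) = ?a * (of_nat (n choose j) * z ^ j)"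
    unfolding sum_binomial_choose[of n z j, symmetric] sum_distrib_left
    by (intro sum.cong refl) (simp only: mult_ac)
  \<comment> \<open>For \<open>k > m\<close> the binomial vanishes, which also disposes of the
    truncated exponent at \<open>k = n\<close>.\<close>
  have "(\<Sum>k\<le>n. of_nat (m choose k) * ?b * z ^ k * (1 - z) ^ (n - k - 1) * of_nat (k choose j))
     = (\<Sum>k\<le>m. of_nat (m choose k) * ?b * z ^ k * (1 - z) ^ (n - k - 1) * of_nat (k choose j))"
    by (rule sum.mono_neutral_right) (auto simp: binomial_eq_0 n)
  also have "\<dots> = (\<Sum>k\<le>m. ?b * (1 - z) * (?B k * of_nat (k choose j)))"
    by (intro sum.cong refl) (simp add: n Suc_diff_le mult_ac)
  also have "\<dots> = ?b * (1 - z) * (of_nat (m choose j) * z ^ j)"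
    unfolding sum_distrib_left[symmetric] sum_binomial_choose ..
  finally have S2: "(\<Sum>k\<le>n. of_nat (m choose k) * ?b * z ^ k * (1 - z) ^ (n - k - 1) * of_nat (k choose j)) = \<dots>" .
  define c1 c2 where "c1 = (if 1 \<le> j then m choose (j - 1) else 0)" and "c2 = (if 2 \<le> j then m choose (j - 2) else 0)"
  have "(\<Sum>k\<le>n. (if k \<ge> 2 then of_nat (m choose (k - 2)) * ?b * z ^ (k - 1) * (1 - z) ^ (n - k) else 0) * of_nat (k choose j))
     = (\<Sum>k=2..m+2. of_nat (m choose (k - 2)) * ?b * z ^ (k - 1) * (1 - z) ^ (n - k) * of_nat (k choose j))"
    by (rule sum.mono_neutral_cong_right) (auto simp: n)
  also have "\<dots> = (\<Sum>k\<le>m. ?b * z * (?B k * of_nat ((k + 2) choose j)))"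
    unfolding sum.shift_bounds_cl_nat_ivl[of _ 0 2 m, unfolded add_0] atMost_atLeast0
    by (intro sum.cong refl) (simp add: n mult_ac)
  also have "\<dots> = ?b * z * (\<Sum>k\<le>m. ?B k * of_nat (k choose j) + 2 * (if 1 \<le> j then ?B k * of_nat (k choose (j - 1)) else 0)
       + (if 2 \<le> j then ?B k * of_nat (k choose (j - 2)) else 0))"
    unfolding sum_distrib_left
    by (intro sum.cong refl) (simp only: add_2_eq_Suc' choose_Suc2, simp add: algebra_simps)
  also have "\<dots> = ?b * z * (of_nat (m choose j) * z ^ j + 2 * (if 1 \<le> j then of_nat (m choose (j - 1)) * z ^ (j - 1) else 0)
       + (if 2 \<le> j then of_nat (m choose (j - 2)) * z ^ (j - 2) else 0))"
    unfolding sum.distrib sum_distrib_left[symmetric]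
    using sum_binomial_choose[of m z] sum_binomial_choose[of m z 0] by simp
  also have "\<dots> = ?b * (of_nat (m choose j) * z ^ Suc j + 2 * of_nat c1 * z ^ j + of_nat c2 * z ^ (j - 1))"
    by (cases j; cases "j - 1") (auto simp: c1_def c2_def algebra_simps)
  finally have S3: "(\<Sum>k\<le>n. (if k \<ge> 2 then of_nat (m choose (k - 2)) * ?b * z ^ (k - 1) * (1 - z) ^ (n - k) else 0) * of_nat (k choose j)) = \<dots>" .
  have nj: "of_nat (n choose j) = (of_nat (m choose j) + 2 * of_nat c1 + of_nat c2 :: complex)"
    unfolding n choose_Suc2 c1_def c2_def by simp
  have sb: "shifted_binomial n j = c2" by (simp add: shifted_binomial_def n c2_def)
  have "(\<Sum>k\<le>n. alpha_bernstein \<alpha> n k z * of_nat (k choose j))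
     = (\<Sum>k\<le>n. of_nat (m choose k) * ?b * z ^ k * (1 - z) ^ (n - k - 1) * of_nat (k choose j))
     + (\<Sum>k\<le>n. (if k \<ge> 2 then of_nat (m choose (k - 2)) * ?b * z ^ (k - 1) * (1 - z) ^ (n - k) else 0) * of_nat (k choose j))
     + (\<Sum>k\<le>n. of_nat (n choose k) * ?a * z ^ k * (1 - z) ^ (n - k) * of_nat (k choose j))"
    unfolding sum.distrib[symmetric] distrib_right[symmetric]
    by (intro sum.cong refl) (simp add: alpha_bernstein_def n)
  also have "\<dots> = of_nat (n choose j) * z ^ j + ?b * of_nat (shifted_binomial n j) * (z ^ (j - 1) - z ^ j)"
    unfolding S1 S2 S3 sb nj by (simp add: algebra_simps)
  finally show ?thesis .
qed

text \<open>The coefficient of \<open>z ^ m\<close> in the image of \<open>z ^ p\<close> under the operator.\<close>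

definition gbd_coeff :: "real \<Rightarrow> nat \<Rightarrow> nat \<Rightarrow> nat \<Rightarrow> real" where
  "gbd_coeff \<alpha> n p m =
     (real (lah p m * fact m) * (real (n choose m) - (1 - \<alpha>) * real (shifted_binomial n m))
      + real (lah p (Suc m) * fact (Suc m)) * (1 - \<alpha>) * real (shifted_binomial n (Suc m)))
     / pochhammer (real n) p"

text \<open>The quotient of rising factorials is the value at \<open>t ^ p\<close> of the functional
  that the operator attaches to \<open>k\<close>, so the left side is the image of
  \<open>z ^ p\<close>. The Lah expansion reduces it to factorial moments.\<close>

lemma sum_alpha_bernstein_pochhammer:
  assumes "n \<ge> 1"
  shows "(\<Sum>k\<le>n. alpha_bernstein \<alpha> n k z * (of_nat (pochhammer k p) / of_nat (pochhammer n p)))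
       = (\<Sum>m\<le>p. of_real (gbd_coeff \<alpha> n p m) * z ^ m)"
proof -
  let ?P = "of_nat (pochhammer n p) :: complex" and ?b = "of_real (1 - \<alpha>) :: complex"
  let ?L = "\<lambda>j. of_nat (lah p j * fact j) :: complex" and ?s = "\<lambda>j. of_nat (shifted_binomial n j) :: complex"
  have "(\<Sum>k\<le>n. alpha_bernstein \<alpha> n k z * of_nat (pochhammer k p))
      = (\<Sum>k\<le>n. \<Sum>j\<le>p. ?L j * (alpha_bernstein \<alpha> n k z * of_nat (k choose j)))"
    unfolding pochhammer_eq_sum_lah of_nat_sum sum_distrib_left
    by (intro sum.cong refl) (simp add: mult_ac)
  also have "\<dots> = (\<Sum>j\<le>p. ?L j * (\<Sum>k\<le>n. alpha_bernstein \<alpha> n k z * of_nat (k choose j)))"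
    by (subst sum.swap) (simp add: sum_distrib_left)
  also have "\<dots> = (\<Sum>j\<le>p. ?L j * (of_nat (n choose j) - ?b * ?s j) * z ^ j) + (\<Sum>j\<le>p. ?L j * ?b * ?s j * z ^ (j - 1))"
    unfolding sum_alpha_bernstein_choose[OF assms] sum.distrib[symmetric]
    by (intro sum.cong refl) (simp add: algebra_simps)
  \<comment> \<open>The shift of range costs nothing: \<open>lah p (Suc p) = 0\<close> at the top,
    and \<open>shifted_binomial n 0 = 0\<close> at the bottom, where \<open>j - 1\<close> is
    truncated.\<close>
  also have "(\<Sum>j\<le>p. ?L j * ?b * ?s j * z ^ (j - 1)) = (\<Sum>j\<le>Suc p. ?L j * ?b * ?s j * z ^ (j - 1))"
    by (simp add: lah_eq_0)
  also have "\<dots> = (\<Sum>j\<le>p. ?L (Suc j) * ?b * ?s (Suc j) * z ^ j)"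
    by (subst sum.atMost_Suc_shift) (simp add: shifted_binomial_def)
  also have "(\<Sum>j\<le>p. ?L j * (of_nat (n choose j) - ?b * ?s j) * z ^ j) + \<dots>
      = (\<Sum>j\<le>p. (?L j * (of_nat (n choose j) - ?b * ?s j) + ?L (Suc j) * ?b * ?s (Suc j)) * z ^ j)"
    unfolding sum.distrib[symmetric] distrib_right ..
  finally have "(\<Sum>k\<le>n. alpha_bernstein \<alpha> n k z * of_nat (pochhammer k p)) / ?P
      = (\<Sum>j\<le>p. (?L j * (of_nat (n choose j) - ?b * ?s j) + ?L (Suc j) * ?b * ?s (Suc j)) * z ^ j) / ?P"
    by simp
  then show ?thesis
    unfolding sum_divide_distrib by (simp add: gbd_coeff_def pochhammer_of_nat del: fact_Suc)
qed

subsection \<open>Bounds and limits of the coefficients\<close>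

lemma alpha_bernstein_at_1:
  assumes "1 \<le> n" "k \<le> n"
  shows "alpha_bernstein \<alpha> n k 1 = (if k = n then 1 else 0)"
proof (cases "n = 1")
  case True
  then show ?thesis using assms by (auto simp: alpha_bernstein_def)
next
  case False
  then have n: "2 \<le> n" using assms by simp
  consider "k = n" | "k = n - 1" "k < n" | "k < n - 1" using assms by linarith
  then show ?thesis
    using n by cases (auto simp: alpha_bernstein_def power_0_left binomial_eq_0)
qed

lemma power_le_pochhammer: "x ^ p \<le> pochhammer x p" if "0 \<le> x" for x :: real
proof (induction p)
  case (Suc p)
  have "x ^ p * x \<le> pochhammer x p * (x + real p)"
    using Suc that order_trans[OF zero_le_power[OF that] Suc] by (intro mult_mono) auto
  then show ?case by (simp add: pochhammer_Suc mult.commute)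
qed simp

lemma pochhammer_real_nonneg: "0 \<le> pochhammer (real n) p"
  using order_trans[OF zero_le_power power_le_pochhammer] by simp

lemma fact_binomial_le_power: "fact p * real (n choose p) \<le> real n ^ p"
proof -
  have "real ((n choose p) * fact p) \<le> real (n ^ p)"
    using binomial_fact_pow of_nat_mono by blast
  then show ?thesis by (simp add: mult.commute)
qed

lemma fact_Suc_binomial_Suc:
  "fact (Suc p) * real (n choose Suc p) = fact p * real (n choose p) * (real n - real p)"
proof -
  have "real (fact p * (n choose p) * (n + p)) = real (fact (Suc p) * (n choose Suc p) + (p + p) * (fact p * (n choose p)))"
    using fact_times_binomial_mult[of p n p] by simp
  then show ?thesis by (simp add: algebra_simps)
qed

text \<open>Induction on \<open>p\<close>: the ratio of falling to rising factorial gains the factor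
  \<open>(n - p) / (n + p)\<close>, and
  \<open>(n + p) * (n - (p + 1)^2) \<le> (n - p^2) * (n - p)\<close>. Once \<open>p > n\<close> the
  left side is no longer positive.\<close>

lemma pochhammer_times_le_fact_binomial:
  assumes "1 \<le> n"
  shows "pochhammer (real n) p * (1 - real p ^ 2 / real n) \<le> fact p * real (n choose p)"
proof (induction p)
  case (Suc p)
  let ?P = "pochhammer (real n) p"
  have P: "0 < ?P" using assms by (intro pochhammer_pos) simp
  show ?case
  proof (cases "p \<le> n")
    case True
    have "?P * (real n + real p) * (real n - real (Suc p) ^ 2) \<le> ?P * (real n - real p ^ 2) * (real n - real p)"
    proof -
      have "(real n + real p) * (real n - real (Suc p) ^ 2) \<le> (real n - real p ^ 2) * (real n - real p)"
        by (simp add: power2_eq_square algebra_simps)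
      then show ?thesis using mult_left_mono[OF _ less_imp_le[OF P]] by (simp add: mult.assoc)
    qed
    then have le: "?P * (real n + real p) * (real n - real (Suc p) ^ 2) / real n \<le> ?P * (real n - real p ^ 2) * (real n - real p) / real n"
      by (rule divide_right_mono) simp
    have eq: "a * (real n - c) / real n = a * (1 - c / real n)" for a c
      using assms by (simp add: field_simps)
    have "pochhammer (real n) (Suc p) * (1 - real (Suc p) ^ 2 / real n)
        = ?P * (real n + real p) * (real n - real (Suc p) ^ 2) / real n"
      unfolding pochhammer_Suc eq ..
    also note le
    also have "?P * (real n - real p ^ 2) * (real n - real p) / real n = ?P * (1 - real p ^ 2 / real n) * (real n - real p)"
      using eq[of "?P * (real n - real p)" "real p ^ 2"] by (simp only: mult_ac)
    also have "\<dots> \<le> fact p * real (n choose p) * (real n - real p)"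
      using Suc True by (intro mult_right_mono) auto
    finally show ?thesis by (simp only: fact_Suc_binomial_Suc)
  next
    case False
    have "real n \<le> real (Suc p) * 1" using False by simp
    also have "\<dots> \<le> real (Suc p) * real (Suc p)" by (intro mult_left_mono) auto
    finally have "1 - real (Suc p) ^ 2 / real n \<le> 0"
      using assms by (simp add: power2_eq_square del: of_nat_Suc)
    then have "pochhammer (real n) (Suc p) * (1 - real (Suc p) ^ 2 / real n) \<le> 0"
      by (intro mult_nonneg_nonpos pochhammer_real_nonneg) (use assms in auto)
    also have "0 \<le> fact (Suc p) * real (n choose Suc p)" by simp
    finally show ?thesis .
  qed
qed simp

text \<open>The power \<open>real n ^ p\<close> separates the two sides; the second factor of the
  rising factorial already exceeds \<open>n\<close>, hence \<open>p \<ge> 2\<close>.\<close>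

lemma fact_binomial_less_pochhammer:
  assumes "1 \<le> n" "2 \<le> p"
  shows "fact p * real (n choose p) < pochhammer (real n) p"
proof -
  obtain q where p: "p = Suc (Suc q)" using assms(2) by (metis Suc_leD Suc_n_not_le_n numeral_2_eq_2 old.nat.exhaust)
  have n: "0 < real n" using assms(1) by simp
  have "real n ^ p = real n ^ q * real n * real n" by (simp add: p mult_ac)
  also have "\<dots> < real n ^ q * (real n + real q) * (real n + real (Suc q))"
    using n by (intro mult_le_less_imp_less mult_left_mono) auto
  also have "\<dots> \<le> pochhammer (real n) q * (real n + real q) * (real n + real (Suc q))"
    by (intro mult_right_mono power_le_pochhammer) auto
  also have "\<dots> = pochhammer (real n) p" by (simp add: p pochhammer_Suc)
  finally show ?thesis using fact_binomial_le_power[of p n] by linarith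
qed

text \<open>With \<open>p = q + 2\<close>, \<open>fact p\<close> is
  \<open>p * (p - 1) * fact q\<close>, and the falling factorial of \<open>n - 2\<close> of order
  \<open>q\<close> is at most \<open>n ^ q\<close>, two powers short of \<open>n ^ p\<close>. Hence
  the \<open>\<alpha>\<close>-dependent correction is of order \<open>1 / n^2\<close>.\<close>

lemma fact_shifted_binomial_le:
  "real n ^ 2 * (fact p * real (shifted_binomial n p)) \<le> real p ^ 2 * real n ^ p"
proof (cases "2 \<le> n \<and> 2 \<le> p")
  case True
  then obtain q where p: "p = Suc (Suc q)" by (metis Suc_leD Suc_n_not_le_n numeral_2_eq_2 old.nat.exhaust)
  have "fact q * real ((n - 2) choose q) \<le> real n ^ q"
    using fact_binomial_le_power[of q "n - 2"] power_mono[of "real (n - 2)" "real n" q] by simp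
  then have "(real p * real (Suc q)) * (fact q * real ((n - 2) choose q)) \<le> (real p * real p) * real n ^ q"
    by (intro mult_mono) (auto simp: p)
  then have "real n ^ 2 * ((real p * real (Suc q)) * (fact q * real ((n - 2) choose q)))
      \<le> real n ^ 2 * ((real p * real p) * real n ^ q)" by (rule mult_left_mono) simp
  then show ?thesis using True by (simp add: shifted_binomial_def p power2_eq_square mult_ac)
qed (auto simp: shifted_binomial_def)

lemma fact_shifted_binomial_div_le:
  assumes "1 \<le> n" "j \<le> p"
  shows "fact j * real (shifted_binomial n j) / pochhammer (real n) p \<le> real j ^ 2 / real n ^ 2"
proof -
  have P: "0 < pochhammer (real n) p" using assms by (intro pochhammer_pos) simp
  have "real n ^ 2 * (fact j * real (shifted_binomial n j)) \<le> real j ^ 2 * real n ^ p"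
    using fact_shifted_binomial_le[of n j] power_increasing[OF assms(2), of "real n"] assms(1)
    by (smt (verit) mult_left_mono of_nat_1 of_nat_mono zero_le_power2)
  also have "\<dots> \<le> real j ^ 2 * pochhammer (real n) p"
    by (intro mult_left_mono power_le_pochhammer) auto
  finally show ?thesis using P assms by (simp add: field_simps)
qed

lemma gbd_coeff_nonneg:
  assumes "\<alpha> \<in> {0..1}"
  shows "0 \<le> gbd_coeff \<alpha> n p m"
proof -
  have "(1 - \<alpha>) * real (shifted_binomial n m) \<le> 1 * real (n choose m)"
    using assms shifted_binomial_le[of n m] by (intro mult_mono) auto
  then show ?thesis
    using assms unfolding gbd_coeff_def
    by (intro divide_nonneg_nonneg add_nonneg_nonneg mult_nonneg_nonneg pochhammer_real_nonneg) auto
qed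

lemma gbd_coeff_eq_0:
  assumes "p < m \<or> n < m"
  shows "gbd_coeff \<alpha> n p m = 0"
  using assms by (auto simp: gbd_coeff_def lah_eq_0 shifted_binomial_def binomial_eq_0)

lemma gbd_coeff_diag:
  "gbd_coeff \<alpha> n p p = (fact p * real (n choose p) - (1 - \<alpha>) * (fact p * real (shifted_binomial n p))) / pochhammer (real n) p"
  by (simp add: gbd_coeff_def lah_diag lah_eq_0 algebra_simps)

text \<open>Put \<open>z = 1\<close>: only the basis polynomial with \<open>k = n\<close> survives,
  and its quotient of rising factorials is 1.\<close>

lemma sum_gbd_coeff:
  assumes "1 \<le> n"
  shows "(\<Sum>m\<le>p. gbd_coeff \<alpha> n p m) = 1"
proof -
  have P: "of_nat (pochhammer n p) \<noteq> (0 :: complex)" using pochhammer_pos[of n p] assms by (simp add: of_nat_eq_0_iff)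
  have "complex_of_real (\<Sum>m\<le>p. gbd_coeff \<alpha> n p m)
      = (\<Sum>k\<le>n. alpha_bernstein \<alpha> n k 1 * (of_nat (pochhammer k p) / of_nat (pochhammer n p)))"
    unfolding sum_alpha_bernstein_pochhammer[OF assms] by simp
  also have "\<dots> = (\<Sum>k\<le>n. if k = n then of_nat (pochhammer k p) / of_nat (pochhammer n p) else 0)"
    using assms by (intro sum.cong refl) (simp add: alpha_bernstein_at_1)
  also have "\<dots> = complex_of_real 1"
    using P by simp
  finally show ?thesis by (simp only: of_real_eq_iff)
qed

text \<open>One \<open>p^2 / n\<close> comes from the ratio of falling to rising factorials, the
  other from the \<open>\<alpha>\<close>-correction, whose \<open>1 / n^2\<close> is weakened to
  \<open>1 / n\<close>.\<close>

lemma one_minus_gbd_coeff_diag_le: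
  assumes "1 \<le> n" "\<alpha> \<in> {0..1}"
  shows "1 - gbd_coeff \<alpha> n p p \<le> 2 * real p ^ 2 / real n"
proof -
  let ?P = "pochhammer (real n) p"
  have P: "0 < ?P" using assms by (intro pochhammer_pos) simp
  have 1: "1 - real p ^ 2 / real n \<le> fact p * real (n choose p) / ?P"
    using pochhammer_times_le_fact_binomial[OF assms(1), of p] P by (simp add: field_simps)
  have "(1 - \<alpha>) * (fact p * real (shifted_binomial n p) / ?P) \<le> 1 * (real p ^ 2 / real n ^ 2)"
    using assms P by (intro mult_mono fact_shifted_binomial_div_le) auto
  also have "\<dots> \<le> real p ^ 2 / real n"
    using mult_right_mono[of 1 "real n" "real p * real p"] assms by (simp add: power2_eq_square field_simps)
  finally show ?thesis using 1 unfolding gbd_coeff_diag by (simp add: diff_divide_distrib)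
qed

text \<open>Dropping the nonnegative \<open>\<alpha>\<close>-correction leaves a bound free of
  \<open>\<alpha>\<close> and strictly below 1, which measures how much a leading coefficient
  shrinks.\<close>

lemma gbd_coeff_diag_bounds:
  assumes "1 \<le> n" "2 \<le> p" "\<alpha> \<in> {0..1}"
  shows "gbd_coeff \<alpha> n p p \<le> fact p * real (n choose p) / pochhammer (real n) p"
    and "fact p * real (n choose p) / pochhammer (real n) p < 1"
proof -
  have P: "0 < pochhammer (real n) p" using assms by (intro pochhammer_pos) simp
  show "gbd_coeff \<alpha> n p p \<le> fact p * real (n choose p) / pochhammer (real n) p"
    unfolding gbd_coeff_diag using assms P by (intro divide_right_mono) auto
  show "fact p * real (n choose p) / pochhammer (real n) p < 1"
    using fact_binomial_less_pochhammer[OF assms(1,2)] P by simp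
qed

text \<open>The coefficient of \<open>z ^ m\<close> in the error committed on
  \<open>z ^ p\<close>.\<close>

definition gbd_dev :: "real \<Rightarrow> nat \<Rightarrow> nat \<Rightarrow> nat \<Rightarrow> real" where
  "gbd_dev \<alpha> n p m = gbd_coeff \<alpha> n p m - (if m = p then 1 else 0)"

text \<open>The coefficients are nonnegative with sum 1, so the mass off the diagonal is \<open>1\<close> minus the
  diagonal coefficient.\<close>

lemma sum_abs_gbd_dev_le:
  assumes "1 \<le> n" "\<alpha> \<in> {0..1}"
  shows "(\<Sum>m\<le>p. \<bar>gbd_dev \<alpha> n p m\<bar>) \<le> 4 * real p ^ 2 / real n"
    and "(\<Sum>m\<le>p. \<bar>gbd_dev \<alpha> n p m\<bar>) \<le> 2"
proof -
  let ?d = "gbd_coeff \<alpha> n p"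
  have split: "(\<Sum>m\<le>p. g m) = (\<Sum>m<p. g m) + g p" for g :: "nat \<Rightarrow> real"
    by (simp add: lessThan_Suc_atMost[symmetric])
  have s: "(\<Sum>m<p. ?d m) = 1 - ?d p" using sum_gbd_coeff[OF assms(1), of \<alpha> p] by (simp add: split)
  moreover have "0 \<le> (\<Sum>m<p. ?d m)" using gbd_coeff_nonneg[OF assms(2)] by (intro sum_nonneg)
  ultimately have d: "\<bar>?d p - 1\<bar> = 1 - ?d p" by simp
  \<comment> \<open>The defect \<open>1 - ?d p\<close> counts twice: on the diagonal and as the sum
    off it.\<close>
  have "(\<Sum>m\<le>p. \<bar>gbd_dev \<alpha> n p m\<bar>) = 2 * (1 - ?d p)"
    unfolding split using s d gbd_coeff_nonneg[OF assms(2)] by (simp add: gbd_dev_def)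
  then show "(\<Sum>m\<le>p. \<bar>gbd_dev \<alpha> n p m\<bar>) \<le> 4 * real p ^ 2 / real n" "(\<Sum>m\<le>p. \<bar>gbd_dev \<alpha> n p m\<bar>) \<le> 2"
    using one_minus_gbd_coeff_diag_le[OF assms, of p] gbd_coeff_nonneg[OF assms(2), of n p p] by auto
qed

lemma gbd_dev_eq_0: "p < m \<Longrightarrow> gbd_dev \<alpha> n p m = 0"
  by (simp add: gbd_dev_def gbd_coeff_eq_0)

lemma abs_gbd_dev_le:
  assumes "1 \<le> n" "\<alpha> \<in> {0..1}"
  shows "\<bar>gbd_dev \<alpha> n p m\<bar> \<le> 4 * real p ^ 2 / real n"
proof (cases "m \<le> p")
  case True
  then have "\<bar>gbd_dev \<alpha> n p m\<bar> \<le> (\<Sum>m\<le>p. \<bar>gbd_dev \<alpha> n p m\<bar>)"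
    by (intro member_le_sum) auto
  then show ?thesis using sum_abs_gbd_dev_le[OF assms, of p] by linarith
qed (simp add: gbd_dev_eq_0)

section \<open>First-order behaviour of the coefficients as \<open>n\<close> grows\<close>

text \<open>Raising \<open>m\<close> by one multiplies the ratio by
  \<open>(n - m) / (n + m) = 1 - 2 * m / (n + m)\<close>, so the limit drops by
  \<open>2 * m\<close>, and \<open>m * (m - 1) + 2 * m = (m + 1) * m\<close>.\<close>

lemma tendsto_times_fact_binomial_div_pochhammer:
  "(\<lambda>n. real n * (fact m * real (n choose m) / pochhammer (real n) m - 1)) \<longlonglongrightarrow> - (real m * (real m - 1))"
proof (induction m)
  case (Suc m)
  let ?x = "\<lambda>n. fact m * real (n choose m) / pochhammer (real n) m"
  have "(\<lambda>n. real n * (?x n - 1) * ((real n - real m) / (real n + real m)) - 2 * real m * (real n / (real n + real m)))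
      \<longlonglongrightarrow> - (real m * (real m - 1)) * 1 - 2 * real m * 1"
    by (intro tendsto_intros Suc) real_asymp+
  moreover have "real n * (?x n - 1) * ((real n - real m) / (real n + real m)) - 2 * real m * (real n / (real n + real m))
      = real n * (fact (Suc m) * real (n choose Suc m) / pochhammer (real n) (Suc m) - 1)" if "1 \<le> n" for n
  proof -
    define x where "x = ?x n"
    have e: "fact (Suc m) * real (n choose Suc m) / pochhammer (real n) (Suc m) = x * ((real n - real m) / (real n + real m))"
      unfolding fact_Suc_binomial_Suc pochhammer_Suc x_def by simp
    \<comment> \<open>Here \<open>c\<close> is \<open>n + m\<close> and \<open>k\<close> is
      \<open>m\<close>, so that \<open>c - 2 * k\<close> becomes \<open>n - m\<close>.\<close>
    have "a * (x - 1) * ((c - 2 * k) / c) - 2 * k * (a / c) = a * (x * ((c - 2 * k) / c) - 1)" if "c \<noteq> 0" for a c k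
      using that by (simp add: field_simps)
    from this[of "real n + real m" "real n" "real m"] that
    show ?thesis unfolding e x_def[symmetric] by (simp add: algebra_simps)
  qed
  ultimately show ?case
    by (auto simp: algebra_simps eventually_sequentially simp del: fact_Suc intro!: exI[of _ 1] elim!: Lim_transform_eventually)
qed simp

lemma tendsto_fact_binomial_div_pochhammer:
  "(\<lambda>n. fact m * real (n choose m) / pochhammer (real n) m) \<longlonglongrightarrow> 1"
proof -
  let ?x = "\<lambda>n. fact m * real (n choose m) / pochhammer (real n) m"
  have "(\<lambda>n. 1 + real n * (?x n - 1) * inverse (real n)) \<longlonglongrightarrow> 1 + - (real m * (real m - 1)) * 0"
    by (intro tendsto_intros tendsto_times_fact_binomial_div_pochhammer lim_inverse_n)
  then have "(\<lambda>n. 1 + real n * (?x n - 1) * inverse (real n)) \<longlonglongrightarrow> 1" by simp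
  moreover have "1 + real n * (?x n - 1) * inverse (real n) = ?x n" if "1 \<le> n" for n
    using that by (simp del: of_nat_Suc add: field_simps)
  ultimately show ?thesis
    by (auto simp: eventually_sequentially elim!: Lim_transform_eventually intro!: exI[of _ 1])
qed

text \<open>The correction is of order \<open>1 / n^2\<close> and so vanishes even after
  multiplication by \<open>n\<close>. The weights \<open>a n\<close> may vary with \<open>n\<close>,
  which later turns limits into bounds uniform in \<open>\<alpha>\<close>.\<close>

lemma tendsto_times_shifted_binomial:
  assumes "j \<le> p" "\<And>n. a n \<in> {0..1}"
  shows "(\<lambda>n. real n * (a n * (fact j * real (shifted_binomial n j) / pochhammer (real n) p))) \<longlonglongrightarrow> 0"
proof (rule tendsto_sandwich)
  show "(\<lambda>_. 0) \<longlonglongrightarrow> (0 :: real)" by simp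
  show "(\<lambda>n. real n * (real j ^ 2 / real n ^ 2)) \<longlonglongrightarrow> 0" by real_asymp
  show "\<forall>\<^sub>F n in sequentially. 0 \<le> real n * (a n * (fact j * real (shifted_binomial n j) / pochhammer (real n) p))"
    using assms(2) by (auto intro!: always_eventually mult_nonneg_nonneg divide_nonneg_nonneg pochhammer_real_nonneg)
  have "real n * (a n * (fact j * real (shifted_binomial n j) / pochhammer (real n) p)) \<le> real n * (1 * (real j ^ 2 / real n ^ 2))"
    if "1 \<le> n" for n
    using assms that by (intro mult_left_mono mult_mono fact_shifted_binomial_div_le divide_nonneg_nonneg pochhammer_real_nonneg mult_nonneg_nonneg) auto
  then show "\<forall>\<^sub>F n in sequentially. real n * (a n * (fact j * real (shifted_binomial n j) / pochhammer (real n) p))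
      \<le> real n * (real j ^ 2 / real n ^ 2)"
    by (auto simp: eventually_sequentially)
qed

text \<open>These limits are the coefficients of the Voronovskaja expression \<open>z (1 - z) f''(z)\<close>.\<close>

lemma tendsto_times_gbd_dev:
  assumes \<alpha>: "\<And>n. \<alpha> n \<in> {0..1}"
  shows "(\<lambda>n. real n * gbd_dev (\<alpha> n) n p m) \<longlonglongrightarrow>
     (if p = m then - (real m * (real m - 1)) else if p = Suc m then real m * (real m + 1) else 0)"
proof -
  let ?P = "\<lambda>n. pochhammer (real n) p"
  let ?b = "\<lambda>n. fact m * real (n choose m) / ?P n"
  let ?s = "\<lambda>j n. (1 - \<alpha> n) * (fact j * real (shifted_binomial n j) / ?P n)"
  have a: "1 - \<alpha> n \<in> {0..1}" for n using \<alpha>[of n] by simp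
  have dev: "real n * gbd_dev (\<alpha> n) n p m = real (lah p m) * (real n * ?b n) - real (lah p m) * (real n * ?s m n)
      + real (lah p (Suc m)) * (real n * ?s (Suc m) n) - (if m = p then real n else 0)" for n
    by (simp add: gbd_dev_def gbd_coeff_def algebra_simps add_divide_distrib diff_divide_distrib del: fact_Suc)
  consider "p < m" | "p = m" | "p = Suc m" | "Suc m < p" by linarith
  then show ?thesis
  proof cases
    case 1
    then show ?thesis by (simp add: gbd_dev_eq_0)
  next
    case 2
    have "(\<lambda>n. real n * (?b n - 1) - real n * ?s m n) \<longlonglongrightarrow> - (real m * (real m - 1)) - 0"
      using 2 tendsto_times_fact_binomial_div_pochhammer tendsto_times_shifted_binomial[of _ _ "\<lambda>n. 1 - \<alpha> n", OF _ a]
      by (intro tendsto_diff) auto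
    then show ?thesis unfolding dev using 2 by (simp add: lah_diag lah_eq_0 algebra_simps)
  next
    case 3
    \<comment> \<open>For \<open>p = Suc m\<close> the denominator has an extra factor
      \<open>n + m\<close>, which absorbs the multiplier \<open>n\<close>; what remains in the limit
      is \<open>lah (Suc m) m\<close>.\<close>
    have "(\<lambda>n. fact m * real (n choose m) / pochhammer (real n) m * (real n / (real n + real m))) \<longlonglongrightarrow> 1 * 1"
      by (intro tendsto_mult tendsto_fact_binomial_div_pochhammer) real_asymp
    then have "(\<lambda>n. real n * ?b n) \<longlonglongrightarrow> 1"
      using 3 by (simp add: pochhammer_Suc mult_ac)
    then have "(\<lambda>n. real (lah p m) * (real n * ?b n) - real (lah p m) * (real n * ?s m n)
      + real (lah p (Suc m)) * (real n * ?s (Suc m) n)) \<longlonglongrightarrow> real (lah p m) * 1 - real (lah p m) * 0 + real (lah p (Suc m)) * 0"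
      using 3 tendsto_times_shifted_binomial[of _ _ "\<lambda>n. 1 - \<alpha> n", OF _ a] by (intro tendsto_intros) (auto simp del: fact_Suc)
    then show ?thesis unfolding dev using 3 by (simp add: lah_subdiag algebra_simps del: fact_Suc)
  next
    case 4
    \<comment> \<open>The rising factorial is at least \<open>n ^ (m + 2)\<close> for
      \<open>n \<ge> 1\<close>, against a numerator of at most \<open>n ^ m\<close>.\<close>
    have "(\<lambda>n. real n * ?b n) \<longlonglongrightarrow> 0"
    proof (rule tendsto_sandwich)
      show "(\<lambda>_. 0) \<longlonglongrightarrow> (0 :: real)" by simp
      show "(\<lambda>n. inverse (real n)) \<longlonglongrightarrow> 0" by (rule lim_inverse_n)
      show "\<forall>\<^sub>F n in sequentially. 0 \<le> real n * ?b n"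
        by (intro always_eventually allI mult_nonneg_nonneg divide_nonneg_nonneg pochhammer_real_nonneg) auto
      have "real n * ?b n \<le> inverse (real n)" if n: "1 \<le> n" for n
      proof -
        have P: "0 < ?P n" using n by (intro pochhammer_pos) simp
        have "real n * real n * (fact m * real (n choose m)) \<le> real n * real n * real n ^ m"
          by (intro mult_left_mono fact_binomial_le_power) auto
        also have "\<dots> = real n ^ Suc (Suc m)" by simp
        also have "\<dots> \<le> real n ^ p" using n 4 by (intro power_increasing) auto
        also have "\<dots> \<le> ?P n" by (intro power_le_pochhammer) simp
        finally show ?thesis using P n by (simp add: field_simps)
      qed
      then show "\<forall>\<^sub>F n in sequentially. real n * ?b n \<le> inverse (real n)" by (auto simp: eventually_sequentially)
    qed
    then have "(\<lambda>n. real (lah p m) * (real n * ?b n) - real (lah p m) * (real n * ?s m n)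
      + real (lah p (Suc m)) * (real n * ?s (Suc m) n)) \<longlonglongrightarrow> real (lah p m) * 0 - real (lah p m) * 0 + real (lah p (Suc m)) * 0"
      using 4 tendsto_times_shifted_binomial[of _ _ "\<lambda>n. 1 - \<alpha> n", OF _ a] by (intro tendsto_intros) (auto simp del: fact_Suc)
    then show ?thesis unfolding dev using 4 by simp
  qed
qed

subsection \<open>Power series\<close>

lemma has_integral_power_times_power:
  "((\<lambda>t. t ^ a * (1 - t) ^ b) has_integral (fact a * fact b / fact (a + b + 1))) {0..1::real}"
proof -
  have "((\<lambda>t. t powr (real (a + 1) - 1) * (1 - t) powr (real (b + 1) - 1)) has_integral Beta (real (a + 1)) (real (b + 1))) {0<..<1}"
    using has_integral_Beta_real[of "real (a + 1)" "real (b + 1)"] by (simp add: has_integral_Icc_iff_Ioo)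
  \<comment> \<open>On the open interval both bases are positive; \<open>powr\<close> and
    \<open>^\<close> differ at base 0 with exponent 0.\<close>
  then have "((\<lambda>t. t ^ a * (1 - t) ^ b) has_integral Beta (real (a + 1)) (real (b + 1))) {0<..<1}"
    by (rule has_integral_eq[rotated]) (auto simp: powr_realpow)
  moreover have "Beta (real (a + 1)) (real (b + 1)) = fact a * fact b / fact (a + b + 1)"
    using Gamma_fact[of a, where 'a = real] Gamma_fact[of b, where 'a = real] Gamma_fact[of "a + b + 1", where 'a = real]
    by (simp add: Beta_def add_ac del: fact_Suc)
  ultimately show ?thesis by (simp add: has_integral_Icc_iff_Ioo)
qed

lemma fact_times_pochhammer: "fact m * pochhammer (real (Suc m)) p = fact (m + p)"
proof (induction p)
  case (Suc p)
  have "fact m * pochhammer (real (Suc m)) (Suc p) = fact m * pochhammer (real (Suc m)) p * (real (Suc m) + real p)"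
    unfolding pochhammer_Suc by (simp only: mult.assoc)
  then show ?case unfolding Suc by simp
qed simp

text \<open>The factor \<open>n - 1\<close> turns the Bernstein weight into the density of the beta
  distribution with parameters \<open>k\<close> and \<open>n - k\<close>, whose moments are these
  quotients.\<close>

lemma integral_Bernstein_times_power:
  assumes "1 \<le> k" "k \<le> n - 1"
  shows "(real n - 1) * integral {0..1} (\<lambda>t. Bernstein (n - 2) (k - 1) t * t ^ p)
       = pochhammer (real k) p / pochhammer (real n) p"
proof -
  obtain i where i: "k = Suc i" using assms(1) by (cases k) auto
  have "k + 1 \<le> n" using assms by linarith
  then obtain j where j: "n = Suc (Suc (i + j))" unfolding i using le_Suc_ex by (metis add_Suc add.right_neutral add_Suc_right One_nat_def)
  have "((\<lambda>t. real ((i + j) choose i) * (t ^ (i + p) * (1 - t) ^ j)) has_integral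
      (real ((i + j) choose i) * (fact (i + p) * fact j / fact (i + p + j + 1)))) {0..1}"
    by (intro has_integral_mult_right has_integral_power_times_power)
  then have "integral {0..1} (\<lambda>t. Bernstein (n - 2) (k - 1) t * t ^ p) = real ((i + j) choose i) * (fact (i + p) * fact j / fact (i + p + j + 1))"
    by (intro integral_unique) (simp add: Bernstein_def i j power_add mult_ac)
  also have "real ((i + j) choose i) = fact (i + j) / (fact i * fact j)"
    using binomial_fact[of i "i + j", where 'a = real] by simp
  also have "fact (i + p) = fact i * pochhammer (real k) p" unfolding i fact_times_pochhammer ..
  also have "fact (i + p + j + 1) = fact (i + j + 1) * pochhammer (real n) p"
    unfolding j using fact_times_pochhammer[of "i + j + 1" p] by (simp add: add_ac del: fact_Suc)
  also have "fact (i + j + 1) = (real n - 1) * fact (i + j)" by (simp add: j)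
  finally have "(real n - 1) * integral {0..1} (\<lambda>t. Bernstein (n - 2) (k - 1) t * t ^ p)
     = ((real n - 1) * fact (i + j) * fact i * fact j) * pochhammer (real k) p
     / (((real n - 1) * fact (i + j) * fact i * fact j) * pochhammer (real n) p)"
    by (simp add: mult_ac)
  then show ?thesis by (subst (asm) mult_divide_mult_cancel_left) (simp_all add: j)
qed

text \<open>The M-test with bounds \<open>C * norm (c p)\<close> gives uniform convergence on the
  unit interval, so summation and integration commute.\<close>

lemma integral_sums_power_series:
  fixes c :: "nat \<Rightarrow> complex" and B :: "real \<Rightarrow> real"
  assumes "summable (\<lambda>p. norm (c p))" "continuous_on {0..1} B"
    and f: "\<And>t. t \<in> {0..1} \<Longrightarrow> (\<lambda>p. c p * of_real t ^ p) sums f (of_real t)"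
  shows "(\<lambda>p. c p * of_real (integral {0..1} (\<lambda>t. B t * t ^ p))) sums integral {0..1} (\<lambda>t. of_real (B t) * f (of_real t))"
proof -
  let ?g = "\<lambda>p t. of_real (B t) * (c p * of_real t ^ p)"
  have "bounded (B ` {0..1})" by (intro compact_imp_bounded compact_continuous_image assms) simp
  then obtain C where C: "\<And>t. t \<in> {0..1} \<Longrightarrow> \<bar>B t\<bar> \<le> C" unfolding bounded_iff by (metis imageI real_norm_def)
  have "uniform_limit {0..1} (\<lambda>N t. \<Sum>p<N. ?g p t) (\<lambda>t. \<Sum>p. ?g p t) sequentially"
  proof (rule Weierstrass_m_test)
    fix p and t :: real assume t: "t \<in> {0..1}"
    show "norm (?g p t) \<le> C * norm (c p)"
    proof -
      have "\<bar>B t\<bar> * (norm (c p) * \<bar>t\<bar> ^ p) \<le> C * (norm (c p) * 1)"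
        using C[OF t] t by (intro mult_mono power_le_one) (auto intro: order_trans[OF abs_ge_zero])
      then show ?thesis by (simp add: norm_mult norm_power)
    qed
  qed (intro summable_mult assms)
  also have "?this \<longleftrightarrow> uniform_limit {0..1} (\<lambda>N t. \<Sum>p<N. ?g p t) (\<lambda>t. of_real (B t) * f (of_real t)) sequentially"
    using f by (intro uniform_limit_cong' refl) (auto simp: sums_iff intro!: sums_unique[symmetric] sums_mult)
  finally obtain I J where I: "\<And>N. ((\<lambda>t. \<Sum>p<N. ?g p t) has_integral I N) {0..1}"
    and J: "((\<lambda>t. of_real (B t) * f (of_real t)) has_integral J) {0..1}" and lim: "I \<longlonglongrightarrow> J"
    by (rule uniform_limit_integral) (auto intro!: continuous_intros assms)
  have int: "((\<lambda>t. ?g p t) has_integral (c p * of_real (integral {0..1} (\<lambda>t. B t * t ^ p)))) {0..1}" for p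
  proof -
    have "((\<lambda>t. B t * t ^ p) has_integral (integral {0..1} (\<lambda>t. B t * t ^ p))) {0..1}"
      by (intro integrable_integral integrable_continuous_interval continuous_intros assms)
    from has_integral_mult_right[OF has_integral_linear[OF this bounded_linear_of_real], of "c p"]
    show ?thesis by (simp add: o_def mult_ac)
  qed
  have "I N = (\<Sum>p<N. c p * of_real (integral {0..1} (\<lambda>t. B t * t ^ p)))" for N
    by (rule has_integral_unique[OF I]) (intro has_integral_sum int, simp)
  with lim have "(\<lambda>p. c p * of_real (integral {0..1} (\<lambda>t. B t * t ^ p))) sums J"
    unfolding sums_def by (metis (no_types, lifting) ext)
  then show ?thesis using J by (simp add: integral_unique)
qed

section \<open>Derivatives of polynomials, and holomorphy of the images\<close>

text \<open>For \<open>j \<le> m\<close> the \<open>pochhammer\<close> factor is the falling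
  factorial of \<open>m\<close> of order \<open>j\<close>; for \<open>j > m\<close> truncated
  subtraction makes it \<open>pochhammer 0 j = 0\<close>, as the derivative requires.\<close>

lemma higher_deriv_sum_powers:
  "(deriv ^^ j) (\<lambda>z. \<Sum>m\<le>p. a m * z ^ m) z
   = (\<Sum>m\<le>p. a m * (pochhammer (of_nat (Suc m - j)) j * z ^ (m - j)))" for a :: "nat \<Rightarrow> complex"
proof (induction p)
  case 0
  show ?case using higher_deriv_cmult[of "\<lambda>w. (w - 0) ^ 0" UNIV z j "a 0"] higher_deriv_power[of j 0 0 z]
    by (simp add: holomorphic_intros)
next
  case (Suc p)
  have "(deriv ^^ j) (\<lambda>z. a (Suc p) * z ^ Suc p) z = a (Suc p) * (pochhammer (of_nat (Suc (Suc p) - j)) j * z ^ (Suc p - j))"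
    using higher_deriv_cmult[of "\<lambda>w. (w - 0) ^ Suc p" UNIV z j "a (Suc p)"] higher_deriv_power[of j 0 "Suc p" z]
    by (simp add: holomorphic_intros del: power_Suc)
  moreover have "(deriv ^^ j) (\<lambda>z. (\<Sum>m\<le>p. a m * z ^ m) + a (Suc p) * z ^ Suc p) z
      = (deriv ^^ j) (\<lambda>z. \<Sum>m\<le>p. a m * z ^ m) z + (deriv ^^ j) (\<lambda>z. a (Suc p) * z ^ Suc p) z"
    by (rule higher_deriv_add[of _ UNIV]) (auto intro!: holomorphic_intros)
  ultimately show ?case using Suc by simp
qed

lemma norm_pochhammer_power_le:
  assumes "1 \<le> \<rho>" "norm z \<le> \<rho>" "1 \<le> j"
  shows "norm (pochhammer (of_nat (Suc m - j)) j * z ^ (m - j) :: complex) \<le> real m ^ j * \<rho> ^ m"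
proof (cases "j \<le> m")
  case True
  have "pochhammer (Suc m - j) j = (\<Prod>i=0..<j. Suc m - j + i)" by (simp add: pochhammer_prod)
  also have "\<dots> \<le> (\<Prod>i=0..<j. m)" using True by (intro prod_mono) auto
  finally have "real (pochhammer (Suc m - j) j) \<le> real (m ^ j)" by (simp only: of_nat_le_iff prod_constant card_atLeastLessThan diff_zero)
  moreover have "norm z ^ (m - j) \<le> \<rho> ^ m"
    using power_mono[OF assms(2) norm_ge_zero, of "m - j"] power_increasing[OF diff_le_self assms(1), of m j] by linarith
  ultimately have "real (pochhammer (Suc m - j) j) * norm z ^ (m - j) \<le> real m ^ j * \<rho> ^ m"
    by (intro mult_mono) auto
  then show ?thesis by (simp only: norm_mult norm_power pochhammer_of_nat norm_of_nat)
next
  case False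
  then have "Suc m - j = 0" by simp
  then show ?thesis using assms by (simp add: pochhammer_0_left)
qed

lemma pochhammer_power_at_0:
  "pochhammer (of_nat (Suc m - j)) j * 0 ^ (m - j) = (if m = j then fact j else 0 :: complex)"
proof -
  consider "m < j" | "m = j" | "j < m" by linarith
  then show ?thesis by cases (auto simp: pochhammer_0_left pochhammer_fact Suc_diff_le)
qed

lemma holomorphic_alpha_bernstein: "alpha_bernstein \<alpha> n k holomorphic_on A"
proof (cases "n = 1")
  case True
  then have "alpha_bernstein \<alpha> n k = (\<lambda>z. if k = 0 then 1 - z else z)" by (auto simp: alpha_bernstein_def)
  then show ?thesis by (cases "k = 0") (auto intro!: holomorphic_intros)
next
  case False
  show ?thesis
  proof (cases "k \<ge> 2")
    case True
    with False show ?thesis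
      unfolding alpha_bernstein_def by (auto intro!: holomorphic_intros)
  next
    case k: False
    with False show ?thesis
      unfolding alpha_bernstein_def by (auto intro!: holomorphic_intros)
  qed
qed

lemma holomorphic_genuine_BD: "genuine_BD \<alpha> n f holomorphic_on A"
  unfolding genuine_BD_def by (intro holomorphic_intros holomorphic_alpha_bernstein)

section \<open>The error of the operator as a power series\<close>

locale power_series_on_disc =
  fixes f :: "complex \<Rightarrow> complex" and c :: "nat \<Rightarrow> complex" and R :: real
  assumes R: "1 < R"
    and holo: "f holomorphic_on ball 0 R"
    and sums: "\<And>z. z \<in> ball 0 R \<Longrightarrow> (\<lambda>p. c p * z ^ p) sums f z"
begin

text \<open>Differentiating and multiplying by \<open>z\<close> weights the coefficients by their
  index without loss of radius; descending from \<open>s\<close> to \<open>\<rho>\<close> gives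
  absolute convergence.\<close>

lemma summable_power_weight:
  assumes "0 \<le> \<rho>" "\<rho> < R"
  shows "summable (\<lambda>p. norm (c p) * real p ^ j * \<rho> ^ p)"
proof -
  have *: "\<forall>z. norm z < R \<longrightarrow> summable (\<lambda>p. of_nat p ^ j * c p * z ^ p)"
  proof (induction j)
    case 0
    then show ?case using sums by (auto simp: sums_iff)
  next
    case (Suc j)
    show ?case
    proof (intro allI impI)
      fix z :: complex assume z: "norm z < R"
      have "summable (\<lambda>p. diffs (\<lambda>p. of_nat p ^ j * c p) p * z ^ p)"
        by (rule termdiff_converges[OF z]) (use Suc in auto)
      then have "summable (\<lambda>p. z * (diffs (\<lambda>p. of_nat p ^ j * c p) p * z ^ p))" by (rule summable_mult)
      also have "(\<lambda>p. z * (diffs (\<lambda>p. of_nat p ^ j * c p) p * z ^ p)) = (\<lambda>p. of_nat (Suc p) ^ Suc j * c (Suc p) * z ^ Suc p)"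
        by (simp add: diffs_def fun_eq_iff mult_ac)
      finally show "summable (\<lambda>p. of_nat p ^ Suc j * c p * z ^ p)" using summable_Suc_iff by blast
    qed
  qed
  obtain s where s: "\<rho> < s" "s < R" using assms dense by blast
  have "summable (\<lambda>p. of_nat p ^ j * c p * of_real s ^ p)" using * s assms by simp
  then have "summable (\<lambda>p. norm (of_nat p ^ j * c p * complex_of_real \<rho> ^ p))"
    by (rule powser_insidea) (use s assms in simp)
  then show ?thesis using assms by (simp add: norm_mult norm_power mult_ac)
qed

lemma summable_norm_coeff: "summable (\<lambda>p. norm (c p))"
  using summable_power_weight[of 1 0] R by simp

text \<open>The evaluations at 0 and 1 obey the same moment formula as the integrals, the quotient
  being \<open>0 ^ p\<close> for \<open>k = 0\<close> and 1 for \<open>k = n\<close>. Each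
  functional acts termwise, and the finite sum over \<open>k\<close> yields the images of
  monomials.\<close>

lemma genuine_BD_sums:
  assumes "1 \<le> n"
  shows "(\<lambda>p. c p * (\<Sum>m\<le>p. of_real (gbd_coeff \<alpha> n p m) * z ^ m)) sums genuine_BD \<alpha> n f z"
proof -
  define I where "I k = (if k = 0 then f 0 else if k = n then f 1 else
     (of_nat n - 1) * integral {0..1} (\<lambda>t. of_real (Bernstein (n - 2) (k - 1) t) * f (of_real t)))" for k
  have I: "(\<lambda>p. c p * (of_nat (pochhammer k p) / of_nat (pochhammer n p))) sums I k" if k: "k \<le> n" for k
  proof -
    have P: "pochhammer n p \<noteq> 0" for p
      using pochhammer_pos[of n p] assms by simp
    consider "k = 0" | "k \<noteq> 0" "k = n" | "1 \<le> k" "k \<le> n - 1" "k \<noteq> n" using k by linarith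
    then show ?thesis
    proof cases
      case 1
      have "(\<lambda>p. c p * (of_nat (pochhammer k p) / of_nat (pochhammer n p))) = (\<lambda>p. c p * 0 ^ p)"
        using 1 by (auto simp: fun_eq_iff pochhammer_0_left power_0_left)
      then show ?thesis using sums[of 0] R 1 by (simp add: I_def)
    next
      case 2
      have "(\<lambda>p. c p * (of_nat (pochhammer k p) / of_nat (pochhammer n p))) = (\<lambda>p. c p * 1 ^ p)"
        unfolding 2(2) using P by (simp only: divide_self of_nat_eq_0_iff not_False_eq_True power_one)
      then show ?thesis using sums[of 1] R 2 by (simp add: I_def)
    next
      case 3
      have "(\<lambda>p. c p * of_real (integral {0..1} (\<lambda>t. Bernstein (n - 2) (k - 1) t * t ^ p)))
          sums integral {0..1} (\<lambda>t. of_real (Bernstein (n - 2) (k - 1) t) * f (of_real t))"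
        by (rule integral_sums_power_series[OF summable_norm_coeff])
          (use R sums in \<open>auto simp: Bernstein_def intro!: continuous_intros\<close>)
      from sums_mult[OF this, of "of_nat n - 1"]
      have "(\<lambda>p. c p * of_real ((real n - 1) * integral {0..1} (\<lambda>t. Bernstein (n - 2) (k - 1) t * t ^ p))) sums I k"
        using 3 by (simp add: I_def mult_ac)
      then show ?thesis unfolding integral_Bernstein_times_power[OF 3(1,2)] by (simp add: pochhammer_of_nat)
    qed
  qed
  have "(\<lambda>p. \<Sum>k\<le>n. alpha_bernstein \<alpha> n k z * (c p * (of_nat (pochhammer k p) / of_nat (pochhammer n p))))
      sums (\<Sum>k\<le>n. alpha_bernstein \<alpha> n k z * I k)"
    by (intro sums_sum sums_mult I) simp
  also have "(\<lambda>p. \<Sum>k\<le>n. alpha_bernstein \<alpha> n k z * (c p * (of_nat (pochhammer k p) / of_nat (pochhammer n p))))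
     = (\<lambda>p. c p * (\<Sum>m\<le>p. of_real (gbd_coeff \<alpha> n p m) * z ^ m))"
    unfolding sum_alpha_bernstein_pochhammer[OF assms, symmetric] sum_distrib_left by (simp add: mult_ac)
  also have "(\<Sum>k\<le>n. alpha_bernstein \<alpha> n k z * I k) = genuine_BD \<alpha> n f z"
  proof -
    obtain n' where n': "n = Suc n'" using assms by (cases n) auto
    have "(\<Sum>k\<le>n. alpha_bernstein \<alpha> n k z * I k)
       = alpha_bernstein \<alpha> n 0 z * I 0 + (\<Sum>k=1..n-1. alpha_bernstein \<alpha> n k z * I k) + alpha_bernstein \<alpha> n n z * I n"
      unfolding n' sum.atMost_Suc by (simp add: atMost_atLeast0 sum.atLeast_Suc_atMost)
    moreover have "(\<Sum>k=1..n-1. alpha_bernstein \<alpha> n k z * I k) = (of_nat n - 1) * (\<Sum>k = 1..n - 1. alpha_bernstein \<alpha> n k z *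
         integral {0..1} (\<lambda>t. of_real (Bernstein (n - 2) (k - 1) t) * f (of_real t)))"
      unfolding sum_distrib_left by (intro sum.cong refl) (auto simp: I_def)
    ultimately show ?thesis using assms by (simp add: genuine_BD_def I_def)
  qed
  finally show ?thesis .
qed

definition err :: "real \<Rightarrow> nat \<Rightarrow> complex \<Rightarrow> complex" where
  "err \<alpha> n z = genuine_BD \<alpha> n f z - f z"

lemma holomorphic_err: "err \<alpha> n holomorphic_on ball 0 R"
  unfolding err_def by (intro holomorphic_intros holomorphic_genuine_BD holo)

lemma higher_deriv_err:
  assumes "z \<in> ball 0 R"
  shows "(deriv ^^ j) (err \<alpha> n) z = (deriv ^^ j) (genuine_BD \<alpha> n f) z - (deriv ^^ j) f z"
  unfolding err_def by (rule higher_deriv_diff[OF holomorphic_genuine_BD holo _ assms]) simp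

lemma err_sums:
  assumes "1 \<le> n" "z \<in> ball 0 R"
  shows "(\<lambda>p. c p * (\<Sum>m\<le>p. of_real (gbd_dev \<alpha> n p m) * z ^ m)) sums err \<alpha> n z"
proof -
  have "(\<lambda>p. c p * (\<Sum>m\<le>p. of_real (gbd_coeff \<alpha> n p m) * z ^ m) - c p * z ^ p) sums err \<alpha> n z"
    unfolding err_def by (intro sums_diff genuine_BD_sums sums assms)
  moreover have "(\<Sum>m\<le>p. of_real (gbd_coeff \<alpha> n p m) * z ^ m) - z ^ p = (\<Sum>m\<le>p. of_real (gbd_dev \<alpha> n p m) * z ^ m)" for p
    by (simp add: gbd_dev_def left_diff_distrib sum_subtractf if_distrib[of of_real] if_distrib[of "\<lambda>x. x * _"] cong: if_cong)
  ultimately show ?thesis by (simp add: right_diff_distrib[symmetric])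
qed

lemma norm_sum_gbd_dev_le:
  assumes "\<And>m. m \<le> p \<Longrightarrow> norm (w m) \<le> B"
  shows "norm (\<Sum>m\<le>p. complex_of_real (gbd_dev \<alpha> n p m) * w m) \<le> (\<Sum>m\<le>p. \<bar>gbd_dev \<alpha> n p m\<bar>) * B"
  unfolding sum_distrib_right
  by (rule sum_norm_le) (auto simp: norm_mult intro!: mult_left_mono assms)

text \<open>Uniform convergence of holomorphic partial sums on a disc around \<open>z\<close>
  permits termwise differentiation.\<close>

lemma higher_deriv_err_sums:
  assumes "1 \<le> n" "\<alpha> \<in> {0..1}" "z \<in> ball 0 R"
  shows "(\<lambda>p. c p * (\<Sum>m\<le>p. of_real (gbd_dev \<alpha> n p m) * (pochhammer (of_nat (Suc m - j)) j * z ^ (m - j))))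
     sums (deriv ^^ j) (err \<alpha> n) z"
proof -
  let ?h = "\<lambda>p z. \<Sum>m\<le>p. complex_of_real (gbd_dev \<alpha> n p m) * z ^ m"
  \<comment> \<open>A radius above 1 gives \<open>\<rho> ^ m \<le> \<rho> ^ p\<close> for
    \<open>m \<le> p\<close>.\<close>
  obtain \<rho> where \<rho>: "max 1 (norm z) < \<rho>" "\<rho> < R" using dense[of "max 1 (norm z)" R] R assms by auto
  have lim: "uniform_limit (ball 0 \<rho>) (\<lambda>N w. \<Sum>p<N. c p * ?h p w) (\<lambda>w. \<Sum>p. c p * ?h p w) sequentially"
  proof (rule Weierstrass_m_test)
    show "summable (\<lambda>p. 2 * (norm (c p) * real p ^ 0 * \<rho> ^ p))"
      using \<rho> by (intro summable_mult summable_power_weight) auto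
    fix p and w :: complex assume w: "w \<in> ball 0 \<rho>"
    have "norm (?h p w) \<le> (\<Sum>m\<le>p. \<bar>gbd_dev \<alpha> n p m\<bar>) * \<rho> ^ p"
    proof (rule norm_sum_gbd_dev_le)
      fix m assume "m \<le> p"
      have "norm w ^ m \<le> \<rho> ^ m" using w by (intro power_mono) auto
      also have "\<dots> \<le> \<rho> ^ p" using \<rho> \<open>m \<le> p\<close> by (intro power_increasing) auto
      finally show "norm (w ^ m) \<le> \<rho> ^ p" by (simp add: norm_power)
    qed
    also have "\<dots> \<le> 2 * \<rho> ^ p"
      using sum_abs_gbd_dev_le(2)[OF assms(1,2)] \<rho> by (intro mult_right_mono) auto
    finally have "norm (c p) * norm (?h p w) \<le> norm (c p) * (2 * \<rho> ^ p)" by (rule mult_left_mono) simp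
    then show "norm (c p * ?h p w) \<le> 2 * (norm (c p) * real p ^ 0 * \<rho> ^ p)" by (simp add: norm_mult)
  qed
  also have "?this \<longleftrightarrow> uniform_limit (ball 0 \<rho>) (\<lambda>N w. \<Sum>p<N. c p * ?h p w) (err \<alpha> n) sequentially"
    using \<rho> by (intro uniform_limit_cong' refl sums_unique[symmetric] err_sums assms) auto
  finally have "(\<lambda>N. (deriv ^^ j) (\<lambda>w. \<Sum>p<N. c p * ?h p w) z) \<longlonglongrightarrow> (deriv ^^ j) (err \<alpha> n) z"
    by (rule higher_deriv_complex_uniform_limit) (use \<rho> in \<open>auto intro!: always_eventually holomorphic_intros\<close>)
  moreover have "(deriv ^^ j) (\<lambda>w. \<Sum>p<N. c p * ?h p w) z
      = (\<Sum>p<N. c p * (\<Sum>m\<le>p. of_real (gbd_dev \<alpha> n p m) * (pochhammer (of_nat (Suc m - j)) j * z ^ (m - j))))" for N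
  proof (induction N)
    case (Suc N)
    have "(deriv ^^ j) (\<lambda>w. (\<Sum>p<N. c p * ?h p w) + c N * ?h N w) z
       = (deriv ^^ j) (\<lambda>w. \<Sum>p<N. c p * ?h p w) z + (deriv ^^ j) (\<lambda>w. c N * ?h N w) z"
      by (rule higher_deriv_add[of _ UNIV]) (auto intro!: holomorphic_intros)
    also have "(deriv ^^ j) (\<lambda>w. c N * ?h N w) z = c N * (deriv ^^ j) (?h N) z"
      by (rule higher_deriv_cmult[of _ UNIV]) (auto intro!: holomorphic_intros)
    finally show ?case using Suc by (simp add: higher_deriv_sum_powers)
  qed simp
  ultimately show ?thesis by (simp add: sums_def)
qed

lemma err_coeff_sums:
  assumes "1 \<le> n" "\<alpha> \<in> {0..1}"
  shows "(\<lambda>p. c p * of_real (gbd_dev \<alpha> n p m)) sums ((deriv ^^ m) (err \<alpha> n) 0 / fact m)"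
proof -
  have "(\<lambda>p. c p * (\<Sum>i\<le>p. of_real (gbd_dev \<alpha> n p i) * (if i = m then fact m else 0)) / fact m) sums ((deriv ^^ m) (err \<alpha> n) 0 / fact m)"
    using sums_divide[OF higher_deriv_err_sums[OF assms, of 0 m], of "fact m"] R
    by (simp only: pochhammer_power_at_0 centre_in_ball)
  moreover have "(\<Sum>i\<le>p. of_real (gbd_dev \<alpha> n p i) * (if i = m then fact m else 0)) = (of_real (gbd_dev \<alpha> n p m) * fact m :: complex)" for p
    by (simp add: if_distrib[of "\<lambda>x. _ * x"] gbd_dev_eq_0 cong: if_cong)
  ultimately show ?thesis by simp
qed

section \<open>The upper bound\<close>

text \<open>In the exponent \<open>l + 2\<close>, the 2 comes from the total deviation of the
  coefficients and \<open>l\<close> from the differentiation.\<close>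

lemma norm_higher_deriv_err_le:
  assumes "1 \<le> n" "\<alpha> \<in> {0..1}" "1 \<le> l" "1 \<le> r" "r < R" "norm z \<le> r"
  shows "norm ((deriv ^^ l) (err \<alpha> n) z) \<le> (\<Sum>p. 4 * (norm (c p) * real p ^ (l + 2) * r ^ p)) / real n"
proof -
  have z: "z \<in> ball 0 R" using assms by simp
  have summ: "summable (\<lambda>p. 4 * (norm (c p) * real p ^ (l + 2) * r ^ p))"
    using assms by (intro summable_mult summable_power_weight) auto
  have b: "norm (\<Sum>m\<le>p. complex_of_real (gbd_dev \<alpha> n p m) * (pochhammer (of_nat (Suc m - l)) l * z ^ (m - l)))
      \<le> (4 * real p ^ 2 / real n) * (real p ^ l * r ^ p)" for p
  proof (rule order_trans[OF norm_sum_gbd_dev_le mult_right_mono[OF sum_abs_gbd_dev_le(1)[OF assms(1,2)]]])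
    fix m assume "m \<le> p"
    have "real m ^ l * r ^ m \<le> real p ^ l * r ^ p"
      using assms \<open>m \<le> p\<close> by (intro mult_mono power_mono power_increasing) auto
    then show "norm (pochhammer (of_nat (Suc m - l)) l * z ^ (m - l)) \<le> real p ^ l * r ^ p"
      using norm_pochhammer_power_le[OF assms(4,6,3), of m] by linarith
  qed (use assms in auto)
  have "norm (c p * (\<Sum>m\<le>p. of_real (gbd_dev \<alpha> n p m) * (pochhammer (of_nat (Suc m - l)) l * z ^ (m - l))))
      \<le> 4 * (norm (c p) * real p ^ (l + 2) * r ^ p) / real n" for p
    using mult_left_mono[OF b[of p] norm_ge_zero[of "c p"]] by (simp add: norm_mult power_add power2_eq_square mult_ac)
  then have "norm ((deriv ^^ l) (err \<alpha> n) z) \<le> (\<Sum>p. 4 * (norm (c p) * real p ^ (l + 2) * r ^ p) / real n)"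
    unfolding sums_unique[OF higher_deriv_err_sums[OF assms(1,2) z, of l]]
    by (rule norm_suminf_le[OF _ summable_divide[OF summ]])
  then show ?thesis by (simp only: suminf_divide[OF summ])
qed

section \<open>The lower bound\<close>

text \<open>Cauchy's inequality for the derivative of order \<open>m - l\<close> of the
  \<open>l\<close>-th derivative; \<open>r \<ge> 1\<close> removes the power of \<open>r\<close>
  from the denominator, and \<open>fact (m - l) \<le> fact m\<close>.\<close>

lemma err_coeff_le_disc_norm:
  assumes "1 \<le> r" "r < R" "l \<le> m"
  shows "norm ((deriv ^^ m) (err \<alpha> n) 0 / fact m) \<le> disc_norm r ((deriv ^^ l) (err \<alpha> n))"
proof -
  let ?g = "(deriv ^^ l) (err \<alpha> n)" and ?B = "disc_norm r ((deriv ^^ l) (err \<alpha> n))"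
  have holo_g: "?g holomorphic_on ball 0 R" by (rule holomorphic_higher_deriv[OF holomorphic_err open_ball])
  have sub: "cball 0 r \<subseteq> ball (0 :: complex) R" using assms by auto
  have cont: "continuous_on (cball 0 r) ?g"
    by (rule continuous_on_subset[OF holomorphic_on_imp_continuous_on[OF holo_g] sub])
  have "bounded (?g ` cball 0 r)" by (intro compact_imp_bounded compact_continuous_image cont) simp
  then have bdd: "bdd_above ((\<lambda>z. norm (?g z)) ` cball 0 r)"
    unfolding bounded_iff bdd_above_def by (auto simp: image_iff)
  have B: "norm (?g z) \<le> ?B" if "norm z \<le> r" for z
    unfolding disc_norm_def using that by (intro cSUP_upper bdd) simp
  have B0: "0 \<le> ?B" using order_trans[OF norm_ge_zero B[of 0]] assms by simp
  have "norm ((deriv ^^ (m - l)) ?g 0) \<le> fact (m - l) * ?B / r ^ (m - l)"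
  proof (rule Cauchy_inequality)
    show "?g holomorphic_on ball 0 r" using holo_g by (rule holomorphic_on_subset) (use assms in auto)
  qed (use assms cont B in auto)
  also have "\<dots> \<le> fact (m - l) * ?B"
    using assms B0 one_le_power[of r "m - l"]
    by (intro order_trans[OF divide_left_mono[of 1 "r ^ (m - l)"]] mult_nonneg_nonneg) (auto intro!: mult_pos_pos)
  also have "\<dots> \<le> fact m * ?B" by (intro mult_right_mono B0 fact_mono) simp
  also have "(deriv ^^ (m - l)) ?g = (deriv ^^ m) (err \<alpha> n)"
    using assms(3) funpow_add[of "m - l" l deriv] by (metis comp_apply le_add_diff_inverse2)
  finally show ?thesis by (simp add: norm_divide field_simps)
qed

text \<open>Tannery's theorem applies because \<open>4 * norm (c p) * p^2\<close> is summable and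
  dominates the terms for all \<open>n \<ge> 1\<close> and all parameters, even when these vary with
  \<open>n\<close>.\<close>

lemma tendsto_times_err_coeff:
  assumes \<alpha>: "\<And>n. \<alpha> n \<in> {0..1}"
  shows "(\<lambda>n. of_nat n * ((deriv ^^ m) (err (\<alpha> n) n) 0 / fact m))
     \<longlonglongrightarrow> of_nat m * (of_nat m + 1) * c (Suc m) - of_nat m * (of_nat m - 1) * c m"
proof -
  \<comment> \<open>The termwise limits; only \<open>p = m\<close> and \<open>p = Suc m\<close>
    survive.\<close>
  define b where "b p = c p * of_real (if p = m then - (real m * (real m - 1)) else if p = Suc m then real m * (real m + 1) else 0)" for p
  let ?a = "\<lambda>p n. c p * of_real (real n * gbd_dev (\<alpha> n) n p m)"
  have "(\<lambda>n. \<Sum>p. ?a p n) \<longlonglongrightarrow> (\<Sum>p. b p)"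
  proof (rule tannerys_theorem[THEN conjunct2, THEN conjunct2])
    show "?a p \<longlonglongrightarrow> b p" for p
      unfolding b_def by (intro tendsto_intros tendsto_times_gbd_dev \<alpha>)
    show "summable (\<lambda>p. 4 * (norm (c p) * real p ^ 2 * 1 ^ p))"
      using R by (intro summable_mult summable_power_weight) auto
    have "norm (?a p n) \<le> 4 * (norm (c p) * real p ^ 2 * 1 ^ p)" if "1 \<le> n" for p n
    proof -
      have "real n * \<bar>gbd_dev (\<alpha> n) n p m\<bar> \<le> 4 * real p ^ 2"
        using abs_gbd_dev_le[OF that \<alpha>, of n p m] that by (simp add: field_simps)
      from mult_left_mono[OF this norm_ge_zero[of "c p"]] show ?thesis by (simp add: norm_mult abs_mult mult_ac)
    qed
    then show "\<forall>\<^sub>F (p, n) in at_top \<times>\<^sub>F sequentially. norm (?a p n) \<le> 4 * (norm (c p) * real p ^ 2 * 1 ^ p)"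
      unfolding eventually_prod_sequentially by (auto intro!: exI[of _ 1])
  qed simp
  moreover have "(\<Sum>p. ?a p n) = of_nat n * ((deriv ^^ m) (err (\<alpha> n) n) 0 / fact m)" if "1 \<le> n" for n
    using sums_mult[OF err_coeff_sums[OF that \<alpha>, of n m], of "of_nat n"] by (simp add: sums_iff mult_ac)
  moreover have "(\<Sum>p. b p) = (\<Sum>p\<in>{m, Suc m}. b p)" by (rule suminf_finite) (auto simp: b_def)
  moreover have "\<dots> = of_nat m * (of_nat m + 1) * c (Suc m) - of_nat m * (of_nat m - 1) * c m"
    by (simp add: b_def algebra_simps)
  ultimately show ?thesis
    by (auto simp: eventually_sequentially elim!: Lim_transform_eventually intro!: exI[of _ 1])
qed

text \<open>If all these quantities vanished, then \<open>m (m - 1) c m\<close> would be constant from \<open>l\<close> on; as the radius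
  of convergence exceeds 1, this constant would be 0.\<close>

lemma ex_nonzero_limit:
  assumes "1 \<le> l" and nz: "\<exists>m\<ge>max 2 l. c m \<noteq> 0"
  shows "\<exists>m\<ge>l. of_nat m * (of_nat m + 1) * c (Suc m) - of_nat m * (of_nat m - 1) * c m \<noteq> 0"
proof (rule ccontr)
  assume "\<not> ?thesis"
  then have step: "of_nat (Suc m) * (of_nat (Suc m) - 1) * c (Suc m) = of_nat m * (of_nat m - 1) * c m" if "l \<le> m" for m
    using that by (auto simp: algebra_simps)
  define K where "K = of_nat l * (of_nat l - 1) * c l"
  have const: "of_nat m * (of_nat m - 1) * c m = K" if "l \<le> m" for m
    using that by (induction m rule: dec_induct) (auto simp: K_def step simp del: of_nat_Suc)
  have "(\<lambda>m. norm (c m) * real m ^ 2 * 1 ^ m) \<longlonglongrightarrow> 0"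
    using R by (intro summable_LIMSEQ_zero summable_power_weight) auto
  moreover have "norm K \<le> norm (c m) * real m ^ 2 * 1 ^ m" if "l \<le> m" for m
  proof -
    have "norm (of_nat m - 1 :: complex) = real m - 1"
      using that assms(1) norm_of_nat[of "m - 1", where 'a = complex] by (simp add: of_nat_diff)
    then have "norm K = real m * (real m - 1) * norm (c m)"
      unfolding const[OF that, symmetric] by (simp add: norm_mult)
    also have "\<dots> \<le> real m * real m * norm (c m)" by (intro mult_right_mono mult_left_mono) auto
    finally show ?thesis by (simp add: power2_eq_square mult_ac)
  qed
  ultimately have "norm K \<le> 0"
    by (intro tendsto_lowerbound[of _ 0 sequentially]) (auto simp: eventually_sequentially)
  obtain m where m: "2 \<le> m" "l \<le> m" "c m \<noteq> 0" using nz by auto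
  then have "of_nat m * (of_nat m - 1) \<noteq> (0 :: complex)" by (auto simp: of_nat_eq_1_iff)
  then show False using const[OF m(2)] m(3) \<open>norm K \<le> 0\<close> by auto
qed

text \<open>A limit valid along every sequence of parameters is uniform in the parameter: violations
  at arbitrarily large \<open>n\<close> would form a sequence contradicting it.\<close>

lemma ex_lower_bound_large:
  assumes "1 \<le> l" "1 \<le> r" "r < R" "\<exists>m\<ge>max 2 l. c m \<noteq> 0"
  shows "\<exists>\<kappa>>0. \<exists>N. \<forall>n\<ge>N. \<forall>\<alpha>\<in>{0..1}. \<kappa> \<le> real n * disc_norm r ((deriv ^^ l) (err \<alpha> n))"
proof -
  obtain m where m: "l \<le> m" and nz: "of_nat m * (of_nat m + 1) * c (Suc m) - of_nat m * (of_nat m - 1) * c m \<noteq> 0" (is "?L \<noteq> 0")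
    using ex_nonzero_limit[OF assms(1,4)] by blast
  let ?e = "\<lambda>\<alpha> n. of_nat n * ((deriv ^^ m) (err \<alpha> n) 0 / fact m)"
  have "\<exists>N. \<forall>n\<ge>N. \<forall>\<alpha>\<in>{0..1}. norm ?L / 2 \<le> norm (?e \<alpha> n)"
  proof (rule ccontr)
    assume contra: "\<not> ?thesis"
    \<comment> \<open>A parameter violating the bound at \<open>n\<close> if there is one, and
      otherwise any point of \<open>{0..1}\<close>.\<close>
    define \<beta> where "\<beta> n = (SOME \<alpha>. \<alpha> \<in> {0..1} \<and> ((\<exists>\<alpha>\<in>{0..1}. norm (?e \<alpha> n) < norm ?L / 2) \<longrightarrow> norm (?e \<alpha> n) < norm ?L / 2))" for n
    have "\<exists>\<alpha>. \<alpha> \<in> {0..1::real} \<and> ((\<exists>\<alpha>\<in>{0..1}. norm (?e \<alpha> n) < norm ?L / 2) \<longrightarrow> norm (?e \<alpha> n) < norm ?L / 2)" for n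
      by (cases "\<exists>\<alpha>\<in>{0..1}. norm (?e \<alpha> n) < norm ?L / 2") (auto intro: exI[of _ 0])
    from someI_ex[OF this] have \<beta>: "\<beta> n \<in> {0..1}"
      "(\<exists>\<alpha>\<in>{0..1}. norm (?e \<alpha> n) < norm ?L / 2) \<Longrightarrow> norm (?e (\<beta> n) n) < norm ?L / 2" for n
      unfolding \<beta>_def by blast+
    have "(\<lambda>n. norm (?e (\<beta> n) n)) \<longlonglongrightarrow> norm ?L"
      by (intro tendsto_norm tendsto_times_err_coeff \<beta>(1))
    moreover have "norm ?L / 2 < norm ?L" using nz by simp
    ultimately have "\<forall>\<^sub>F n in sequentially. norm ?L / 2 < norm (?e (\<beta> n) n)" by (rule order_tendstoD(1))
    then obtain N where "\<And>n. n \<ge> N \<Longrightarrow> norm ?L / 2 < norm (?e (\<beta> n) n)" by (auto simp: eventually_sequentially)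
    then show False using contra \<beta>(2) by (meson less_asym not_le_imp_less)
  qed
  moreover have "norm (?e \<alpha> n) \<le> real n * disc_norm r ((deriv ^^ l) (err \<alpha> n))" for \<alpha> n
    unfolding norm_mult norm_of_nat using err_coeff_le_disc_norm[OF assms(2,3) m, of \<alpha> n] by (intro mult_left_mono) auto
  ultimately have "\<exists>N. \<forall>n\<ge>N. \<forall>\<alpha>\<in>{0..1}. norm ?L / 2 \<le> real n * disc_norm r ((deriv ^^ l) (err \<alpha> n))"
    by (meson order_trans)
  moreover have "0 < norm ?L / 2" using nz by simp
  ultimately show ?thesis by blast
qed

text \<open>The image under the operator has degree at most \<open>n\<close>. So either \<open>f\<close> has a nonzero coefficient beyond \<open>n\<close>,
  or its leading coefficient is strictly shrunk.\<close>

lemma ex_lower_bound_each: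
  assumes "1 \<le> r" "r < R" "1 \<le> n" and nz: "\<exists>m\<ge>max 2 l. c m \<noteq> 0"
  shows "\<exists>\<kappa>>0. \<forall>\<alpha>\<in>{0..1}. \<kappa> \<le> disc_norm r ((deriv ^^ l) (err \<alpha> n))"
proof -
  have "\<exists>m\<ge>l. \<exists>\<kappa>>0. \<forall>\<alpha>\<in>{0..1}. \<kappa> \<le> norm ((deriv ^^ m) (err \<alpha> n) 0 / fact m)"
  proof (cases "\<exists>m\<ge>max l (Suc n). c m \<noteq> 0")
    case True
    then obtain m where m: "l \<le> m" "n < m" "c m \<noteq> 0" by auto
    \<comment> \<open>The image has no coefficient beyond \<open>n\<close>, so the error has that of
      \<open>-f\<close>, whatever \<open>\<alpha>\<close> is.\<close>
    have "(deriv ^^ m) (err \<alpha> n) 0 / fact m = - c m" if "\<alpha> \<in> {0..1}" for \<alpha>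
    proof (rule sums_unique2[OF err_coeff_sums[OF assms(3) that]])
      have "(\<lambda>p. if p = m then - c p else 0) sums (- c m)" using sums_single[of m "\<lambda>p. - c p"] by simp
      moreover have "(\<lambda>p. if p = m then - c p else 0) = (\<lambda>p. c p * of_real (gbd_dev \<alpha> n p m))"
        using m by (auto simp: gbd_dev_def gbd_coeff_eq_0)
      ultimately show "(\<lambda>p. c p * of_real (gbd_dev \<alpha> n p m)) sums (- c m)" by simp
    qed
    then show ?thesis using m by (intro exI[of _ m] conjI exI[of _ "norm (c m)"]) auto
  next
    case False
    \<comment> \<open>Here \<open>f\<close> is a polynomial, and the largest element of
      \<open>?S\<close> is its degree.\<close>
    let ?S = "{m. max 2 l \<le> m \<and> c m \<noteq> 0}"
    have fin: "finite ?S" 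
    proof (rule finite_subset)
      show "?S \<subseteq> {..n}"
      proof
        fix m assume "m \<in> ?S"
        with False have "\<not> max l (Suc n) \<le> m" "l \<le> m" by auto
        then show "m \<in> {..n}" by simp
      qed
    qed simp
    have "?S \<noteq> {}" using nz by auto
    define m where "m = Max ?S"
    have m: "2 \<le> m" "l \<le> m" "c m \<noteq> 0" using Max_in[OF fin \<open>?S \<noteq> {}\<close>] by (auto simp: m_def)
    have above: "c p = 0" if "m < p" for p
    proof (rule ccontr)
      assume "c p \<noteq> 0"
      then have "p \<in> ?S" using m that by auto
      then show False using Max_ge[OF fin] that by (simp add: m_def leD)
    qed
    let ?x = "fact m * real (n choose m) / pochhammer (real n) m"
    have "norm (c m) * (1 - ?x) \<le> norm ((deriv ^^ m) (err \<alpha> n) 0 / fact m)" if \<alpha>: "\<alpha> \<in> {0..1}" for \<alpha>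
    proof -
      \<comment> \<open>Only \<open>p = m\<close> contributes: larger \<open>p\<close> have
        \<open>c p = 0\<close>, and smaller \<open>p\<close> give images of degree below
        \<open>m\<close>.\<close>
      have "(\<lambda>p. if p = m then c p * of_real (gbd_dev \<alpha> n p p) else 0) sums (c m * of_real (gbd_dev \<alpha> n m m))"
        using sums_single[of m "\<lambda>p. c p * of_real (gbd_dev \<alpha> n p p)"] by simp
      moreover have "(\<lambda>p. if p = m then c p * of_real (gbd_dev \<alpha> n p p) else 0) = (\<lambda>p. c p * of_real (gbd_dev \<alpha> n p m))"
      proof
        fix p show "(if p = m then c p * of_real (gbd_dev \<alpha> n p p) else 0) = c p * of_real (gbd_dev \<alpha> n p m)"
          using above gbd_dev_eq_0 by (cases p m rule: linorder_cases) auto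
      qed
      ultimately have "(deriv ^^ m) (err \<alpha> n) 0 / fact m = c m * of_real (gbd_dev \<alpha> n m m)"
        using sums_unique2[OF err_coeff_sums[OF assms(3) \<alpha>]] by simp
      moreover have "1 - ?x \<le> \<bar>gbd_dev \<alpha> n m m\<bar>"
        using gbd_coeff_diag_bounds[OF assms(3) m(1) \<alpha>] by (simp add: gbd_dev_def)
      ultimately show ?thesis by (simp only: norm_mult norm_of_real) (simp add: mult_left_mono)
    qed
    moreover have "?x < 1" using gbd_coeff_diag_bounds(2)[OF assms(3) m(1), of 0] by simp
    ultimately show ?thesis using m by (intro exI[of _ m] conjI exI[of _ "norm (c m) * (1 - ?x)"]) auto
  qed
  then show ?thesis using err_coeff_le_disc_norm[OF assms(1,2)] by (meson order_trans)
qed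

text \<open>The finitely many small \<open>n\<close> are covered one at a time, taking the minimum
  of the constants.\<close>

lemma ex_lower_bound:
  assumes "1 \<le> l" "1 \<le> r" "r < R" "\<exists>m\<ge>max 2 l. c m \<noteq> 0"
  shows "\<exists>\<kappa>>0. \<forall>n\<ge>1. \<forall>\<alpha>\<in>{0..1}. \<kappa> \<le> real n * disc_norm r ((deriv ^^ l) (err \<alpha> n))"
proof -
  let ?D = "\<lambda>n \<alpha>. real n * disc_norm r ((deriv ^^ l) (err \<alpha> n))"
  obtain \<kappa> N where \<kappa>: "0 < \<kappa>" "\<And>n \<alpha>. N \<le> n \<Longrightarrow> \<alpha> \<in> {0..1} \<Longrightarrow> \<kappa> \<le> ?D n \<alpha>"
    using ex_lower_bound_large[OF assms] by blast
  have "\<exists>\<kappa>'>0. \<forall>n\<in>{1..M}. \<forall>\<alpha>\<in>{0..1}. \<kappa>' \<le> ?D n \<alpha>" for M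
  proof (induction M)
    case 0
    show ?case by (auto intro: exI[of _ 1])
  next
    case (Suc M)
    then obtain a where a: "0 < a" "\<forall>n\<in>{1..M}. \<forall>\<alpha>\<in>{0..1}. a \<le> ?D n \<alpha>" by blast
    obtain b where b: "0 < b" "\<forall>\<alpha>\<in>{0..1}. b \<le> disc_norm r ((deriv ^^ l) (err \<alpha> (Suc M)))"
      using ex_lower_bound_each[OF assms(2,3) _ assms(4), of "Suc M"] by auto
    have "b \<le> ?D (Suc M) \<alpha>" if "\<alpha> \<in> {0..1}" for \<alpha>
    proof -
      have "1 * b \<le> ?D (Suc M) \<alpha>" using b that by (intro mult_mono) auto
      then show ?thesis by simp
    qed
    then have "\<forall>n\<in>{1..Suc M}. \<forall>\<alpha>\<in>{0..1}. min a b \<le> ?D n \<alpha>"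
      using a(2) by (auto simp: atLeastAtMostSuc_conv min_le_iff_disj simp del: of_nat_Suc)
    then show ?case using a(1) b(1) by (intro exI[of _ "min a b"]) auto
  qed
  then obtain \<kappa>' where \<kappa>': "0 < \<kappa>'" "\<And>n \<alpha>. n \<in> {1..N} \<Longrightarrow> \<alpha> \<in> {0..1} \<Longrightarrow> \<kappa>' \<le> ?D n \<alpha>" by blast
  have "min \<kappa> \<kappa>' \<le> ?D n \<alpha>" if "1 \<le> n" "\<alpha> \<in> {0..1}" for n \<alpha>
    using \<kappa>(2)[of n \<alpha>] \<kappa>'(2)[of n \<alpha>] that by (cases "N \<le> n") (auto simp: min_le_iff_disj)
  then show ?thesis using \<kappa>(1) \<kappa>'(1) by (intro exI[of _ "min \<kappa> \<kappa>'"]) auto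
qed

lemma ex_nonzero_coeff:
  assumes "\<not> (\<exists>P :: complex poly. degree P \<le> d \<and> (\<forall>z\<in>ball 0 R. f z = poly P z))"
  shows "\<exists>m>d. c m \<noteq> 0"
proof (rule ccontr)
  assume "\<not> ?thesis"
  then have z: "c p = 0" if "d < p" for p using that by auto
  let ?P = "\<Sum>p\<le>d. monom (c p) p"
  have "degree ?P \<le> d" by (intro degree_sum_le) (auto intro: order_trans[OF degree_monom_le])
  moreover have "f w = poly ?P w" if "w \<in> ball 0 R" for w
  proof -
    have "(\<lambda>p. c p * w ^ p) sums (\<Sum>p\<le>d. c p * w ^ p)"
      by (rule sums_finite) (auto simp: z)
    then show ?thesis using sums_unique2[OF sums[OF that]] by (simp add: poly_sum poly_monom)
  qed
  ultimately show False using assms by blast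
qed

end

theorem theorem4:
  fixes f :: "complex \<Rightarrow> complex" and c :: "nat \<Rightarrow> complex"
    and R r r\<^sub>1 :: real and l :: nat
  assumes "R > 1"
    and "f analytic_on ball 0 R"
    and "\<And>z. z \<in> ball 0 R \<Longrightarrow> (\<lambda>p. c p * z ^ p) sums f z"
    and "l \<ge> 1"
    and "\<not> (\<exists>P :: complex poly. degree P \<le> max 1 (l - 1) \<and> (\<forall>z\<in>ball 0 R. f z = poly P z))"
    and "1 \<le> r" and "r < r\<^sub>1" and "r\<^sub>1 < R"
  shows "\<exists>M\<^sub>1 M\<^sub>2 :: real. 0 < M\<^sub>1 \<and> M\<^sub>1 \<le> M\<^sub>2 \<and>
    (\<forall>\<alpha>\<in>{0..1}. \<forall>n\<ge>1.
       M\<^sub>1 / real n \<le> disc_norm r (\<lambda>z. (deriv ^^ l) (genuine_BD \<alpha> n f) z - (deriv ^^ l) f z) \<and>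
       disc_norm r (\<lambda>z. (deriv ^^ l) (genuine_BD \<alpha> n f) z - (deriv ^^ l) f z) \<le> M\<^sub>2 / real n)"
proof -
  interpret power_series_on_disc f c R
    using assms(1-3) by unfold_locales (auto intro: analytic_imp_holomorphic)
  have r: "r < R" using assms(7,8) by simp
  have nz: "\<exists>m\<ge>max 2 l. c m \<noteq> 0"
  proof -
    \<comment> \<open>Exceeding both 1 and \<open>l - 1\<close> amounts to being at least 2 and at
      least \<open>l\<close>.\<close>
    obtain m where "max 1 (l - 1) < m" "c m \<noteq> 0" using ex_nonzero_coeff[OF assms(5)] by blast
    then show ?thesis by (intro exI[of _ m]) auto
  qed
  let ?D = "\<lambda>\<alpha> n. disc_norm r (\<lambda>z. (deriv ^^ l) (genuine_BD \<alpha> n f) z - (deriv ^^ l) f z)"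
  have D: "?D \<alpha> n = disc_norm r ((deriv ^^ l) (err \<alpha> n))" for \<alpha> n
    unfolding disc_norm_def using r by (intro SUP_cong refl) (simp add: higher_deriv_err)
  obtain \<kappa> where \<kappa>: "0 < \<kappa>" "\<And>n \<alpha>. 1 \<le> n \<Longrightarrow> \<alpha> \<in> {0..1} \<Longrightarrow> \<kappa> \<le> real n * ?D \<alpha> n"
    unfolding D using ex_lower_bound[OF assms(4,6) r nz] by blast
  \<comment> \<open>The series involves only \<open>c\<close>, \<open>l\<close> and
    \<open>r\<close>, so the constant is uniform in \<open>n\<close> and
    \<open>\<alpha>\<close>.\<close>
  define M where "M = (\<Sum>p. 4 * (norm (c p) * real p ^ (l + 2) * r ^ p))"
  have up: "?D \<alpha> n \<le> M / real n" if "1 \<le> n" "\<alpha> \<in> {0..1}" for n \<alpha>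
    unfolding D unfolding disc_norm_def M_def
    using assms(6) by (intro cSUP_least norm_higher_deriv_err_le that assms(4,6) r) auto
  \<comment> \<open>Compare the two bounds at \<open>n = 1\<close> and
    \<open>\<alpha> = 0\<close>.\<close>
  have "\<kappa> \<le> M" using \<kappa>(2)[of 1 0] up[of 1 0] by simp
  moreover have "\<kappa> / real n \<le> ?D \<alpha> n" if "1 \<le> n" "\<alpha> \<in> {0..1}" for n \<alpha>
    using \<kappa>(2)[OF that] that by (simp add: field_simps)
  ultimately show ?thesis using \<kappa>(1) up by blast
qed

end
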